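(* For every positive integer $m$ let $\lambda_{2,m}=\{\{1,2\},\{3,4\},\ldots,\{2m-1,2m\}\}\in\mathrm{NC}(2m)$ and let $$\widetilde d_{2,m}:=\frac{1}{\mathrm{Cat}_{2m}}\sum_{\rho\in\mathrm{NC}(2m)}d_H(\lambda_{2,m},\rho).$$ Then $$\widetilde d_{2,m}=\frac{2^{2m-1}\binom{2m}{m}}{\mathrm{Cat}_{2m}}-\frac32 ,$$ and consequently $$\lim_{m\to\infty}\bigl(\widetilde d_{2,m}-\sqrt2\,m\bigr)=\frac{7\sqrt2}{16}-\frac32 .$$
   Context: For a positive integer $n$, a partition $\pi$ of $\{1,\ldots,n\}$ is non-crossing if there are no two distinct blocks $V,W$ of $\pi$ and numbers $a<b<c<d$ with $a,c\in V$ and $b,d\in W$. $\mathrm{NC}(n)$ is the set of non-crossing partitions of $\{1,\ldots,n\}$, partially ordered by $\pi\le\rho$ iff every block of $\pi$ is contained in a block of $\rho$. The Hasse diagram $\mathcal{H}_n$ is the undirected graph with vertex set $\mathrm{NC}(n)$ in which $\pi_1,\pi_2$ are joined by an edge iff one of them covers the other in $(\mathrm{NC}(n),\le)$; $d_H(\pi,\rho)$ is the graph distance in $\mathcal{H}_n$. $\mathrm{Cat}_n=\frac{(2n)!}{n!(n+1)!}=|\mathrm{NC}(n)|$ is the $n$th Catalan number. *)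

theory Defs
  imports
    "HOL-Analysis.Analysis"
    "HOL-Library.Disjoint_Sets"
    "Graph_Theory.Graph_Theory"
begin

definition noncrossing :: "nat set set \<Rightarrow> bool" where
  "noncrossing \<pi> \<longleftrightarrow>
     \<not> (\<exists>V\<in>\<pi>. \<exists>W\<in>\<pi>. V \<noteq> W \<and>
          (\<exists>a b c d. a < b \<and> b < c \<and> c < d \<and> a \<in> V \<and> c \<in> V \<and> b \<in> W \<and> d \<in> W))"

definition NC :: "nat \<Rightarrow> nat set set set" where
  "NC n = {\<pi>. partition_on {1..n} \<pi> \<and> noncrossing \<pi>}"

text \<open>On \<open>NC n\<close> the order \<open>\<le>\<close> is \<open>refines {1..n}\<close>.\<close>

definition nc_less :: "nat \<Rightarrow> nat set set \<Rightarrow> nat set set \<Rightarrow> bool" where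
  "nc_less n \<pi> \<rho> \<longleftrightarrow>
     \<pi> \<in> NC n \<and> \<rho> \<in> NC n \<and> refines {1..n} \<pi> \<rho> \<and> \<pi> \<noteq> \<rho>"

definition nc_covers :: "nat \<Rightarrow> nat set set \<Rightarrow> nat set set \<Rightarrow> bool" where
  "nc_covers n \<rho> \<pi> \<longleftrightarrow>
     nc_less n \<pi> \<rho> \<and> \<not> (\<exists>\<sigma>. nc_less n \<pi> \<sigma> \<and> nc_less n \<sigma> \<rho>)"

text \<open>The undirected Hasse diagram is encoded as a digraph with both arcs for every edge.\<close>

definition hasse :: "nat \<Rightarrow> (nat set set, nat set set \<times> nat set set) pre_digraph" where
  "hasse n =
     \<lparr> verts = NC n,
       arcs = {(\<pi>, \<rho>). nc_covers n \<pi> \<rho> \<or> nc_covers n \<rho> \<pi>},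
       tail = fst, head = snd \<rparr>"

text \<open>
  With unit arc weights \<open>\<mu>\<close> is the minimal length of a walk. It is \<open>\<infinity>\<close> for unconnected
  vertices, which does not occur here: see \<open>ereal_d_H\<close> below.
\<close>

definition d_H :: "nat \<Rightarrow> nat set set \<Rightarrow> nat set set \<Rightarrow> real" where
  "d_H n \<pi> \<rho> = real_of_ereal (wf_digraph.\<mu> (hasse n) (\<lambda>_. 1) \<pi> \<rho>)"

definition Cat :: "nat \<Rightarrow> real" where
  "Cat n = fact (2 * n) / (fact n * fact (n + 1))"

definition lambda2 :: "nat \<Rightarrow> nat set set" where
  "lambda2 m = (\<lambda>i. {2 * i - 1, 2 * i}) ` {1..m}"

definition dtilde2 :: "nat \<Rightarrow> real" where
  "dtilde2 m = 1 / Cat (2 * m) * (\<Sum>\<rho>\<in>NC (2 * m). d_H (2 * m) (lambda2 m) \<rho>)"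


text \<open>Well-definedness.\<close>

lemma lambda2_in_NC: "lambda2 m \<in> NC (2 * m)"
proof -
  have "\<Union> (lambda2 m) = {1..2 * m}"
  proof (intro set_eqI iffI)
    fix x assume "x \<in> {1..2 * m}"
    then have "(x + 1) div 2 \<in> {1..m}" "x \<in> {2 * ((x + 1) div 2) - 1, 2 * ((x + 1) div 2)}"
      by auto
    then show "x \<in> \<Union> (lambda2 m)"
      unfolding lambda2_def by blast
  qed (auto simp: lambda2_def)
  moreover have "disjoint (lambda2 m)"
    by (auto simp: lambda2_def disjoint_def) presburger+
  moreover have "{} \<notin> lambda2 m"
    by (auto simp: lambda2_def)
  moreover have "noncrossing (lambda2 m)"
    by (auto simp: lambda2_def noncrossing_def)
  ultimately show ?thesis
    by (simp add: NC_def partition_on_def)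
qed

lemma finite_NC: "finite (NC n)"
  by (rule finite_subset[OF _ finitely_many_partition_on[of "{1..n}"]]) (auto simp: NC_def)

lemma wf_digraph_hasse: "wf_digraph (hasse n)"
  by unfold_locales (auto simp: hasse_def nc_covers_def nc_less_def)

lemma nc_less_trans: "nc_less n \<pi> \<rho> \<Longrightarrow> nc_less n \<rho> \<sigma> \<Longrightarrow> nc_less n \<pi> \<sigma>"
  unfolding nc_less_def by (metis refines_trans refines_asym)

lemma wf_nc_less: "wf {(\<pi>, \<rho>). nc_less n \<pi> \<rho>}" "wf ({(\<pi>, \<rho>). nc_less n \<pi> \<rho>}\<inverse>)"
proof -
  let ?R = "{(\<pi>, \<rho>). nc_less n \<pi> \<rho>}"
  have "finite ?R"
    by (rule finite_subset[of _ "NC n \<times> NC n"]) (auto simp: nc_less_def finite_NC)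
  moreover have "trans ?R"
    by (auto intro!: transI intro: nc_less_trans)
  then have "acyclic ?R"
    by (auto simp: acyclic_def nc_less_def)
  ultimately show "wf ?R" "wf (?R\<inverse>)"
    by (simp_all add: finite_acyclic_wf finite_acyclic_wf_converse)
qed

lemma ereal_d_H:
  assumes "\<pi> \<in> NC n" "\<rho> \<in> NC n"
  shows "ereal (d_H n \<pi> \<rho>) = wf_digraph.\<mu> (hasse n) (\<lambda>_. 1) \<pi> \<rho>"
proof -
  interpret wf_digraph "hasse n" by (rule wf_digraph_hasse)
  define B where "B = (\<lambda>i. {i}) ` {1..n}"
  have B: "B \<in> NC n" and B_le: "refines {1..n} B \<sigma>" if "\<sigma> \<in> NC n" for \<sigma>
    using that by (auto simp: B_def NC_def noncrossing_def refines_def partition_on_singletons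
        dest!: partition_onD1)
  have dom: "(\<sigma> \<rightarrow>\<^bsub>hasse n\<^esub> \<tau>) \<and> (\<tau> \<rightarrow>\<^bsub>hasse n\<^esub> \<sigma>)" if "nc_covers n \<tau> \<sigma>" for \<sigma> \<tau>
    using that by (force simp: hasse_def arcs_ends_def arc_to_ends_def)
  have *: "\<sigma> \<rightarrow>\<^sup>*\<^bsub>hasse n\<^esub> B \<and> B \<rightarrow>\<^sup>*\<^bsub>hasse n\<^esub> \<sigma>" if "\<sigma> \<in> NC n" for \<sigma>
    using wf_nc_less(1)[of n] that
  proof (induction \<sigma> rule: wf_induct_rule)
    case (less \<sigma>)
    show ?case
    proof (cases "\<sigma> = B")
      case True
      have "\<sigma> \<in> verts (hasse n)" using less.prems by (simp add: hasse_def)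
      then show ?thesis using True by auto
    next
      case False
      then have "B \<in> {\<tau>. nc_less n \<tau> \<sigma>}"
        using B B_le less.prems by (auto simp: nc_less_def)
      from wfE_min[OF wf_nc_less(2)[of n] this] obtain \<tau>
        where \<tau>: "nc_less n \<tau> \<sigma>" "\<And>\<upsilon>. nc_less n \<tau> \<upsilon> \<Longrightarrow> \<not> nc_less n \<upsilon> \<sigma>"
        by auto
      then have "nc_covers n \<sigma> \<tau>" by (auto simp: nc_covers_def)
      moreover have "\<tau> \<rightarrow>\<^sup>*\<^bsub>hasse n\<^esub> B \<and> B \<rightarrow>\<^sup>*\<^bsub>hasse n\<^esub> \<tau>"
        using less.IH[of \<tau>] \<tau>(1) by (simp add: nc_less_def)
      ultimately show ?thesis
        using dom by (meson reachable_adj_trans adj_reachable_trans)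
    qed
  qed
  then have "\<pi> \<rightarrow>\<^sup>*\<^bsub>hasse n\<^esub> \<rho>"
    using assms reachable_trans by blast
  then obtain p where "awalk \<pi> p \<rho>"
    by (auto simp: reachable_awalk)
  then have "\<mu> (\<lambda>_. 1) \<pi> \<rho> \<le> ereal (awalk_cost (\<lambda>_. 1) p)"
    by (rule min_cost_le_walk_cost)
  moreover have "0 \<le> \<mu> (\<lambda>_. 1) \<pi> \<rho>"
    unfolding \<mu>_def by (intro INF_greatest) (auto intro: pos_cost_pos_awalk_cost)
  ultimately show ?thesis
    unfolding d_H_def by (cases "\<mu> (\<lambda>_. 1) \<pi> \<rho>") auto
qed

end

(* For a partition L into intervals, d_H(L, r) = |L| + |r| - 2 |L v r|: the join L v r is noncrossing,
   and merging two blocks changes the right-hand side by one. Cutting a noncrossing partition at the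
   hull of a component of its join with L gives, with F(z) = sum Cat_{2m} z^m and A the series of the
   partitions whose join connects first and last point, F = 1 + A F and A (zF)' for the total number
   of components. For L the partition into singletons the same cut yields the Catalan numbers and the
   average |r|; for pairs it leaves the logarithmic derivative of
   F(x^2) = (sqrt(1 + 4x) - sqrt(1 - 4x)) / (4x). *)
theory Submission
  imports
    Defs
    "HOL-Computational_Algebra.Formal_Power_Series"
    "HOL-Real_Asymp.Real_Asymp"
begin

section \<open>Noncrossing equivalence relations\<close>

text \<open>The join formed among noncrossing partitions can be coarser than the join of set
  partitions; a walk through the former may then be longer than the lower bound, which counts
  components of the latter. For intervals the two joins agree: a point between two points of a block
  lies in that block, so a chord of \<open>L\<close> has no point of another class under it. Since
  the ordinary join is a transitive closure, partitions are handled as equivalence relations. The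
  factor \<open>(zF)'\<close> records positions: a hull of \<open>k\<close> blocks of length
  \<open>q\<close> fits among \<open>n\<close> blocks in \<open>n - k + 1\<close> places, and the
  points outside it carry an arbitrary noncrossing partition. The series \<open>A\<close> is
  eliminated: \<open>A = 1 - 1/F\<close> turns \<open>A (zF)'\<close> into
  \<open>(zF)' - 1 - zF'/F\<close>. This last quotient is explicit because, with
  \<open>a = sqrt (1 + 4x)\<close>, \<open>b = sqrt (1 - 4x)\<close> and \<open>h = a b\<close>, the
  square of \<open>a - b\<close> is \<open>2 - 2h\<close>, so that only \<open>1/h\<close>, a series
  of central binomial coefficients in \<open>x^2\<close>, survives.\<close>

text \<open>The chord from \<open>x\<close> to \<open>y\<close> does not separate \<open>u\<close> from \<open>v\<close>. In this form the condition is
  additive along paths, so it passes to transitive closures.\<close>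

definition nc_rel :: "nat rel \<Rightarrow> bool" where
  "nc_rel E \<longleftrightarrow> (\<forall>x y u v. (x, y) \<in> E \<longrightarrow> (u, v) \<in> E \<longrightarrow> (x, u) \<notin> E \<longrightarrow>
     ((x < u) = (y < u)) = ((x < v) = (y < v)))"

definition ncr :: "nat set \<Rightarrow> nat rel set" where
  "ncr S = {E. equiv S E \<and> nc_rel E}"

lemma nc_relD:
  "nc_rel E \<Longrightarrow> (x, y) \<in> E \<Longrightarrow> (u, v) \<in> E \<Longrightarrow> (x, u) \<notin> E \<Longrightarrow>
     ((x < u) = (y < u)) = ((x < v) = (y < v))"
  unfolding nc_rel_def by blast

text \<open>Chords of different classes have four distinct endpoints and separate each other exactly
  in the eight interleavings of these points; each interleaving is one instance of the four-point
  condition.\<close>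

lemma nc_rel_iff:
  assumes "equiv S E"
  shows "nc_rel E \<longleftrightarrow>
    (\<forall>a b c d. a < b \<longrightarrow> b < c \<longrightarrow> c < d \<longrightarrow> (a, c) \<in> E \<longrightarrow> (b, d) \<in> E \<longrightarrow> (a, b) \<in> E)"
    (is "_ \<longleftrightarrow> ?R")
proof
  assume nc: "nc_rel E"
  show ?R
  proof (intro allI impI, rule ccontr)
    fix a b c d assume "a < b" "b < c" "c < d" "(a, c) \<in> E" "(b, d) \<in> E" "(a, b) \<notin> E"
    then show False using nc_relD[OF nc, of a c b d] by simp
  qed
next
  assume R: ?R
  have sym: "(b, a) \<in> E" if "(a, b) \<in> E" for a b
    using that assms by (auto elim!: equivE dest: symD)
  have tr: "(a, c) \<in> E" if "(a, b) \<in> E" "(b, c) \<in> E" for a b c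
    using that assms by (auto elim!: equivE dest: transD)
  show "nc_rel E"
    unfolding nc_rel_def
  proof (intro allI impI)
    fix x y u v assume xy: "(x, y) \<in> E" and uv: "(u, v) \<in> E" and nu: "(x, u) \<notin> E"
    have yx: "(y, x) \<in> E" and vu: "(v, u) \<in> E" using xy uv sym by auto
    have nv: "(x, v) \<notin> E" using nu vu tr by blast
    have nyu: "(y, u) \<notin> E" and nyv: "(y, v) \<notin> E" using nu nv xy tr by blast+
    have ne: "x \<noteq> u" "x \<noteq> v" "y \<noteq> u" "y \<noteq> v"
      using tr[OF xy yx] tr[OF yx xy] nu nv nyu nyv by auto
    have no: "\<not> (a < b \<and> b < c \<and> c < d)"
      if "(a, c) \<in> E" "(b, d) \<in> E" "(a, b) \<notin> E \<or> (b, a) \<notin> E" for a b c d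
      using R that sym by blast
    have flip: "(u < x) = (\<not> x < u)" "(v < x) = (\<not> x < v)" "(u < y) = (\<not> y < u)" "(v < y) = (\<not> y < v)"
      using ne by linarith+
    note no[of x y u v] no[of x y v u] no[of y x u v] no[of y x v u]
      no[of u v x y] no[of u v y x] no[of v u x y] no[of v u y x]
    then have "\<not> (x < u \<and> u < y \<and> y < v)" "\<not> (x < v \<and> v < y \<and> y < u)"
      "\<not> (y < u \<and> u < x \<and> x < v)" "\<not> (y < v \<and> v < x \<and> x < u)"
      "\<not> (u < x \<and> x < v \<and> v < y)" "\<not> (u < y \<and> y < v \<and> v < x)"
      "\<not> (v < x \<and> x < u \<and> u < y)" "\<not> (v < y \<and> y < u \<and> u < x)"
      using xy yx uv vu nu nv nyu nyv by simp_all
    then show "((x < u) = (y < u)) = ((x < v) = (y < v))"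
      unfolding flip by argo
  qed
qed

lemma equiv_trancl:
  assumes "equiv S E" "M \<subseteq> S \<times> S" "sym M"
  shows "equiv S ((E \<union> M)\<^sup>+)"
proof (rule equivI)
  have E: "E \<subseteq> S \<times> S" "refl_on S E" "sym E"
    using assms by (auto elim: equivE)
  then show "(E \<union> M)\<^sup>+ \<subseteq> S \<times> S"
    using assms(2) by (intro trancl_subset_Sigma) auto
  show "refl_on S ((E \<union> M)\<^sup>+)"
    using E(2) by (auto simp: refl_on_def)
  show "sym ((E \<union> M)\<^sup>+)"
    using E(3) assms(3) by (intro sym_trancl sym_Un)
qed simp

text \<open>One induction per chord: first the path from \<open>x\<close> to \<open>y\<close> grows
  against a single generator, then the path from \<open>u\<close> to \<open>v\<close>. The premise
  \<open>(x, u) \<notin> G\<^sup>+\<close> survives each step because a path stays inside its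
  class.\<close>

lemma nc_rel_trancl:
  assumes G: "sym G"
    and nc: "\<And>x y u v. (x, y) \<in> G \<Longrightarrow> (u, v) \<in> G \<Longrightarrow> (x, u) \<notin> G\<^sup>+ \<Longrightarrow>
      ((x < u) = (y < u)) = ((x < v) = (y < v))"
  shows "nc_rel (G\<^sup>+)"
proof -
  have 1: "((x < u) = (y < u)) = ((x < v) = (y < v))"
    if "(x, y) \<in> G\<^sup>+" "(u, v) \<in> G" "(x, u) \<notin> G\<^sup>+" for x y u v
    using that
  proof (induction rule: trancl_induct)
    case (base y)
    then show ?case using nc by blast
  next
    case (step y z)
    then have "(y, u) \<notin> G\<^sup>+"
      by (meson trancl_trans)
    then have "((y < u) = (z < u)) = ((y < v) = (z < v))"
      using nc step by blast
    then show ?case using step by blast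
  qed
  have "((x < u) = (y < u)) = ((x < v) = (y < v))"
    if "(u, v) \<in> G\<^sup>+" "(x, y) \<in> G\<^sup>+" "(x, u) \<notin> G\<^sup>+" for x y u v
    using that
  proof (induction rule: trancl_induct)
    case (base v)
    then show ?case using 1 by blast
  next
    case (step v w)
    have "(x, v) \<notin> G\<^sup>+"
      using step.hyps(1) step.prems G by (meson sym_trancl symD trancl_trans)
    then have "((x < v) = (y < v)) = ((x < w) = (y < w))"
      using 1 step by blast
    then show ?case using step by blast
  qed
  then show ?thesis unfolding nc_rel_def by blast
qed

lemma ncr_trancl:
  assumes E: "E \<in> ncr S" and M: "M \<subseteq> S \<times> S" "sym M"
    and MM: "\<And>x y u v. (x, y) \<in> M \<Longrightarrow> (u, v) \<in> M \<Longrightarrow> (x, u) \<notin> (E \<union> M)\<^sup>+ \<Longrightarrow>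
      ((x < u) = (y < u)) = ((x < v) = (y < v))"
    and ME: "\<And>x y u v. (x, y) \<in> M \<Longrightarrow> (u, v) \<in> E \<Longrightarrow> (x, u) \<notin> (E \<union> M)\<^sup>+ \<Longrightarrow>
      ((x < u) = (y < u)) = ((x < v) = (y < v))"
  shows "(E \<union> M)\<^sup>+ \<in> ncr S"
proof -
  have eq: "equiv S E" and nc: "nc_rel E" using E by (auto simp: ncr_def)
  have symE: "sym E" using eq by (auto elim: equivE)
  have "equiv S ((E \<union> M)\<^sup>+)" using equiv_trancl[OF eq M] .
  then have symJ: "sym ((E \<union> M)\<^sup>+)" by (auto elim: equivE)
  have "nc_rel ((E \<union> M)\<^sup>+)"
  proof (rule nc_rel_trancl)
    show "sym (E \<union> M)" using symE M(2) by (rule sym_Un)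
    fix x y u v assume a: "(x, y) \<in> E \<union> M" "(u, v) \<in> E \<union> M" and n: "(x, u) \<notin> (E \<union> M)\<^sup>+"
    consider "(x, y) \<in> M" "(u, v) \<in> M" | "(x, y) \<in> M" "(u, v) \<in> E" |
      "(x, y) \<in> E" "(u, v) \<in> E" | "(x, y) \<in> E" "(u, v) \<in> M" using a by blast
    then show "((x < u) = (y < u)) = ((x < v) = (y < v))"
    proof cases
      case 1 then show ?thesis using MM n by blast
    next
      case 2 then show ?thesis using ME n by blast
    next
      case 3
      then have "(x, u) \<notin> E" using n by auto
      then show ?thesis using nc_relD[OF nc 3] by blast
    next
      case 4
      have n': "(u, x) \<notin> (E \<union> M)\<^sup>+" using n symJ by (meson symD)
      \<comment> \<open>\<open>ME\<close> covers this case with the two chords exchanged, hence with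
        \<open>u < x\<close> in place of \<open>x < u\<close>; the two are complementary only
        because the endpoints differ.\<close>
      have "((u < x) = (v < x)) = ((u < y) = (v < y))" using ME 4 n' by blast
      moreover have "x \<noteq> u" "x \<noteq> v" "y \<noteq> u" "y \<noteq> v"
      proof -
        have J: "(x, y) \<in> (E \<union> M)\<^sup>+" "(v, u) \<in> (E \<union> M)\<^sup>+"
          using 4 M(2) by (auto dest: symD)
        have "(x, x) \<in> (E \<union> M)\<^sup>+" using J(1) symJ by (meson symD trancl_trans)
        then show "x \<noteq> u" "x \<noteq> v" "y \<noteq> u" "y \<noteq> v"
          using n J by (auto dest: trancl_trans)
      qed
      ultimately show ?thesis by linarith
    qed
  qed
  then show ?thesis using \<open>equiv S ((E \<union> M)\<^sup>+)\<close> by (simp add: ncr_def)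
qed

text \<open>If \<open>u\<close> lies between two points of a class of \<open>L\<close>, convexity
  puts it into that class. So points outside the class lie beside its chords, never under
  them.\<close>

lemma ncr_join_convex:
  assumes E: "E \<in> ncr S" and L: "equiv S L"
    and conv: "\<And>v w z. (v, w) \<in> L \<Longrightarrow> z \<in> S \<Longrightarrow> v \<le> z \<Longrightarrow> z \<le> w \<Longrightarrow> (v, z) \<in> L"
  shows "(E \<union> L)\<^sup>+ \<in> ncr S"
proof -
  have L': "L \<subseteq> S \<times> S" "sym L" "trans L" using L by (auto elim: equivE)
  have E': "E \<subseteq> S \<times> S" using E by (auto simp: ncr_def elim: equivE)
  have "(x < u) = (y < u)" if "(x, y) \<in> L" "u \<in> S" "(x, u) \<notin> (E \<union> L)\<^sup>+" for x y u
  proof (rule ccontr)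
    assume "(x < u) \<noteq> (y < u)"
    then have "(x, u) \<in> L"
      using that(1,2) conv[of x y u] conv[of y x u] L'(2,3)
      by (meson symD transD linorder_not_less nless_le)
    then show False using that(3) by auto
  qed note * = this
  have **: "((x < u) = (y < u)) = ((x < v) = (y < v))"
    if "(x, y) \<in> L" "(u, v) \<in> E \<union> L" "(x, u) \<notin> (E \<union> L)\<^sup>+" for x y u v
  proof -
    have "u \<in> S" "v \<in> S" using that(2) E' L' by auto
    moreover have "(x, v) \<notin> (E \<union> L)\<^sup>+"
    proof
      assume "(x, v) \<in> (E \<union> L)\<^sup>+"
      moreover have "(v, u) \<in> (E \<union> L)\<^sup>+"
        using that(2) L'(2) E by (auto simp: ncr_def dest: symD elim!: equivE)
      ultimately show False using that(3) by (meson trancl_trans)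
    qed
    ultimately show ?thesis using *[OF that(1)] that(3) by blast
  qed
  show ?thesis
    by (rule ncr_trancl[OF E L'(1,2)]) (use ** in blast)+
qed

section \<open>Merging two classes\<close>

abbreviation merge :: "nat rel \<Rightarrow> nat \<Rightarrow> nat \<Rightarrow> nat rel" where
  "merge E v w \<equiv> (E \<union> {(v, w), (w, v)})\<^sup>+"

lemma equiv_merge: "equiv S E \<Longrightarrow> v \<in> S \<Longrightarrow> w \<in> S \<Longrightarrow> equiv S (merge E v w)"
  by (rule equiv_trancl) (auto simp: sym_def)

lemma merge_eq:
  assumes "equiv S E" "v \<in> S" "w \<in> S"
  shows "merge E v w = E \<union> E `` {v} \<times> E `` {w} \<union> E `` {w} \<times> E `` {v}" (is "?l = ?r")
proof
  have E: "E \<subseteq> S \<times> S" "refl_on S E" "sym E" "trans E"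
    using assms by (auto elim: equivE)
  have 1: "(a, c) \<in> E" if "(a, b) \<in> E" "(b, c) \<in> E" for a b c using that E(4) by (meson transD)
  have 2: "(b, a) \<in> E" if "(a, b) \<in> E" for a b using that E(3) by (meson symD)
  have "trans ?r"
  proof (rule transI)
    fix a b c assume "(a, b) \<in> ?r" "(b, c) \<in> ?r"
    then show "(a, c) \<in> ?r"
      by (elim UnE SigmaE2; simp; meson 1 2)
  qed
  moreover have "E \<union> {(v, w), (w, v)} \<subseteq> ?r"
    using E(2) assms by (auto simp: refl_on_def)
  ultimately show "?l \<subseteq> ?r"
    by (metis trancl_id trancl_mono_subset)
  have "(x, y) \<in> ?l \<and> (y, x) \<in> ?l" if "(v, x) \<in> E" "(w, y) \<in> E" for x y
  proof -
    have "(x, v) \<in> E" "(y, w) \<in> E" using that E(3) by (auto dest: symD)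
    then have "(x, v) \<in> ?l" "(v, w) \<in> ?l" "(w, y) \<in> ?l" "(y, w) \<in> ?l" "(w, v) \<in> ?l" "(v, x) \<in> ?l"
      using that by auto
    then show ?thesis by (meson trancl_trans)
  qed
  then show "?r \<subseteq> ?l" by auto
qed

lemma card_merge:
  assumes "finite S" "equiv S E" "v \<in> S" "w \<in> S" "(v, w) \<notin> E"
  shows "card (S // E) = Suc (card (S // merge E v w))"
proof -
  have E: "E \<subseteq> S \<times> S" "refl_on S E" "sym E" "trans E"
    using assms by (auto elim: equivE)
  let ?V = "E `` {v}" and ?W = "E `` {w}"
  have fin: "finite (S // E)" using assms(1) E(1) by (rule finite_quotient)
  have VW: "?V \<in> S // E" "?W \<in> S // E" "?V \<noteq> ?W"
    using assms by (auto simp: eq_equiv_class_iff intro: quotientI)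
  have ne: "?V \<union> ?W \<notin> S // E"
  proof
    assume "?V \<union> ?W \<in> S // E"
    then obtain x where "?V \<union> ?W = E `` {x}" by (auto elim: quotientE)
    moreover have "v \<in> ?V" "w \<in> ?W" using assms(3,4) E(2) by (auto simp: refl_on_def)
    ultimately have "(x, v) \<in> E" "(x, w) \<in> E" by blast+
    then show False using assms(5) E(3,4) by (meson symD transD)
  qed
  have tr: "(a, c) \<in> E" if "(a, b) \<in> E" "(b, c) \<in> E" for a b c using that E(4) by (meson transD)
  have sy: "(b, a) \<in> E" if "(a, b) \<in> E" for a b using that E(3) by (meson symD)
  have cls: "merge E v w `` {x} = (if x \<in> ?V \<union> ?W then ?V \<union> ?W else E `` {x})" for x
  proof (rule set_eqI)
    fix y
    have "y \<in> merge E v w `` {x} \<longleftrightarrow>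
        (x, y) \<in> E \<or> (v, x) \<in> E \<and> (w, y) \<in> E \<or> (w, x) \<in> E \<and> (v, y) \<in> E"
      unfolding merge_eq[OF assms(2-4)] by auto
    then show "y \<in> merge E v w `` {x} \<longleftrightarrow> y \<in> (if x \<in> ?V \<union> ?W then ?V \<union> ?W else E `` {x})"
      by simp (meson tr sy)
  qed
  have "S // merge E v w = insert (?V \<union> ?W) (S // E - {?V, ?W})"
  proof
    show "S // merge E v w \<subseteq> insert (?V \<union> ?W) (S // E - {?V, ?W})"
    proof
      fix X assume "X \<in> S // merge E v w"
      then obtain x where x: "x \<in> S" "X = merge E v w `` {x}" by (auto elim: quotientE)
      have "E `` {x} \<noteq> ?V \<and> E `` {x} \<noteq> ?W" if "x \<notin> ?V \<union> ?W"
        using that x(1) assms(2-4) sy by (simp add: eq_equiv_class_iff) blast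
      then show "X \<in> insert (?V \<union> ?W) (S // E - {?V, ?W})"
        using x cls[of x] by (auto intro: quotientI)
    qed
    show "insert (?V \<union> ?W) (S // E - {?V, ?W}) \<subseteq> S // merge E v w"
    proof
      fix X assume "X \<in> insert (?V \<union> ?W) (S // E - {?V, ?W})"
      then consider "X = ?V \<union> ?W" | "X \<in> S // E" "X \<noteq> ?V" "X \<noteq> ?W" by blast
      then show "X \<in> S // merge E v w"
      proof cases
        case 1
        moreover have "v \<in> ?V" using assms(3) E(2) by (auto simp: refl_on_def)
        ultimately have "X = merge E v w `` {v}" using cls[of v] by auto
        then show ?thesis using assms(3) by (auto intro: quotientI)
      next
        case 2
        then obtain x where x: "x \<in> S" "X = E `` {x}" by (auto elim: quotientE)
        then have "x \<notin> ?V \<union> ?W" using 2(2,3) equiv_class_eq[OF assms(2)] by blast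
        then have "X = merge E v w `` {x}" using cls[of x] x by auto
        then show ?thesis using x(1) by (auto intro: quotientI)
      qed
    qed
  qed
  then have "card (S // merge E v w) = Suc (card (S // E - {?V, ?W}))"
    using ne fin by simp
  moreover have "card (S // E - {?V, ?W}) = card (S // E) - 2"
    using VW fin by (subst card_Diff_subset) auto
  moreover have "card {?V, ?W} \<le> card (S // E)"
    using VW fin by (intro card_mono) auto
  ultimately show ?thesis using VW(3) by simp
qed

text \<open>Merging commutes with joining: an edge of the Hasse diagram acts on the join with
  \<open>L\<close> as a single merge, possibly a trivial one, so the number of components moves by
  at most one.\<close>

lemma merge_Un:
  "(merge E v w \<union> L)\<^sup>+ = merge ((E \<union> L)\<^sup>+) v w"
proof -
  have *: "(A\<^sup>+ \<union> B)\<^sup>+ = (A \<union> B)\<^sup>+" for A B :: "nat rel"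
  proof
    have "A\<^sup>+ \<union> B \<subseteq> (A \<union> B)\<^sup>+" by (auto intro: trancl_mono)
    then show "(A\<^sup>+ \<union> B)\<^sup>+ \<subseteq> (A \<union> B)\<^sup>+" by (metis trancl_id trancl_mono_subset trans_trancl)
    show "(A \<union> B)\<^sup>+ \<subseteq> (A\<^sup>+ \<union> B)\<^sup>+" by (rule trancl_mono_subset) auto
  qed
  have "(merge E v w \<union> L)\<^sup>+ = ((E \<union> {(v, w), (w, v)}) \<union> L)\<^sup>+" by (rule *)
  also have "(E \<union> {(v, w), (w, v)}) \<union> L = (E \<union> L) \<union> {(v, w), (w, v)}" by blast
  also have "\<dots>\<^sup>+ = merge ((E \<union> L)\<^sup>+) v w" by (rule *[symmetric])
  finally show ?thesis .
qed

lemma merge_same: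
  assumes "equiv S E" "(v, w) \<in> E"
  shows "merge E v w = E"
proof -
  have E: "sym E" "trans E" using assms(1) by (auto elim: equivE)
  then have "(w, v) \<in> E" using assms(2) by (meson symD)
  then have "E \<union> {(v, w), (w, v)} = E" using assms(2) by blast
  then show ?thesis using E(2) by simp
qed

text \<open>This yields the grading by the number of blocks. The pair \<open>(v, w)\<close> is a
  closest one in \<open>E' - E\<close>. A chord outside its \<open>E'\<close>-class is not separated
  by it, as \<open>E'\<close> is noncrossing; inside that class minimality leaves no point strictly
  between \<open>v\<close> and \<open>w\<close>.\<close>

lemma ncr_merge_between:
  assumes E: "E \<in> ncr S" and E': "E' \<in> ncr S" and sub: "E \<subset> E'"
  obtains v w where "(v, w) \<in> E' - E" "merge E v w \<in> ncr S" "merge E v w \<subseteq> E'"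
proof -
  have e: "E \<subseteq> S \<times> S" "sym E" "trans E" "refl_on S E"
    and e': "E' \<subseteq> S \<times> S" "sym E'" "trans E'" "refl_on S E'"
    using E E' by (auto simp: ncr_def elim: equivE)
  \<comment> \<open>a pair at minimal distance: no element of its \<open>E'\<close>-class lies strictly in between\<close>
  define P where "P = (\<lambda>(v, w). (v, w) \<in> E' - E \<and> v < (w::nat))"
  obtain x y where xy: "(x, y) \<in> E' - E" using sub by auto
  then have "x \<noteq> y" using e(4) e'(1) by (auto simp: refl_on_def)
  then have "P (x, y) \<or> P (y, x)"
    using xy e(2) e'(2) by (auto simp: P_def dest: symD)
  then obtain vw where vw: "P vw" "\<And>z. P z \<Longrightarrow> snd vw - fst vw \<le> snd z - fst z"
    using exists_least_iff[of "\<lambda>n. \<exists>z. P z \<and> snd z - fst z = n"] by (metis not_le_imp_less)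
  obtain v w where [simp]: "vw = (v, w)" by (cases vw)
  have vw1: "(v, w) \<in> E'" "(v, w) \<notin> E" "v < w" using vw(1) by (auto simp: P_def)
  then have S: "v \<in> S" "w \<in> S" using e'(1) by auto
  have gap: "\<not> (v < z \<and> z < w)" if "(v, z) \<in> E'" for z
  proof
    assume z: "v < z \<and> z < w"
    have "(z, w) \<in> E'" using that vw1 e'(2,3) by (meson symD transD)
    moreover have "(v, z) \<notin> E \<or> (z, w) \<notin> E" using vw1(2) e(3) by (meson transD)
    ultimately have "P (v, z) \<or> P (z, w)" using that z by (auto simp: P_def)
    then show False using vw(2)[of "(v, z)"] vw(2)[of "(z, w)"] z by auto
  qed
  let ?M = "{(v, w), (w, v)}"
  have sub': "merge E v w \<subseteq> E'"
  proof -
    have "E \<union> ?M \<subseteq> E'" using sub vw1 e'(2) by (auto dest: symD)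
    then show ?thesis using e'(3) by (metis trancl_id trancl_mono_subset)
  qed
  have nc: "((x < a) = (y < a)) = ((x < b) = (y < b))"
    if "(x, y) \<in> ?M" "(a, b) \<in> E \<union> ?M" "(x, a) \<notin> merge E v w" for x y a b
  proof -
    have xy: "(x, y) \<in> E'" using that(1) vw1 e'(2) by (auto dest: symD)
    have ab: "(a, b) \<in> E'" using that(2) vw1 e'(2) sub by (auto dest: symD)
    show ?thesis
    proof (cases "(x, a) \<in> E'")
      case False
      then show ?thesis using nc_relD[OF _ xy ab] E' by (auto simp: ncr_def)
    next
      case True
      have eqm: "equiv S (merge E v w)" using E S by (intro equiv_merge) (auto simp: ncr_def)
      then have m: "sym (merge E v w)" "refl_on S (merge E v w)" by (auto elim: equivE)
      have abm: "(b, a) \<in> merge E v w" using that(2) m(1) by (meson r_into_trancl' symD)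
      have "(x, v) \<in> merge E v w \<and> (x, w) \<in> merge E v w"
        using that(1) m(2) S by (auto simp: refl_on_def)
      then have *: "a \<noteq> v" "a \<noteq> w" "b \<noteq> v" "b \<noteq> w"
        using that(3) abm by (auto dest: trancl_trans)
      have "(v, a) \<in> E'" "(v, b) \<in> E'"
        using True ab that(1) vw1(1) e'(2,3) by (auto dest: symD transD)
      then have "\<not> (v < a \<and> a < w)" "\<not> (v < b \<and> b < w)" using gap by blast+
      then have "(v < a) = (w < a)" "(v < b) = (w < b)" using * vw1(3) by linarith+
      then show ?thesis using that(1) by auto
    qed
  qed
  have "merge E v w \<in> ncr S"
    by (rule ncr_trancl[OF E]) (use S nc in \<open>auto simp: sym_def\<close>)
  then show ?thesis using that[of v w] vw1 sub' by blast
qed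

lemma card_quotient_less:
  fixes S :: "nat set"
  assumes "finite S" "equiv S E" "equiv S E'" "E \<subset> E'"
  shows "card (S // E') < card (S // E)"
proof -
  obtain v w where vw: "(v, w) \<in> E'" "(v, w) \<notin> E" using assms(4) by auto
  have e': "E' \<subseteq> S \<times> S" "sym E'" "trans E'" using assms by (auto elim: equivE)
  then have S: "v \<in> S" "w \<in> S" using vw by auto
  have "E \<union> {(v, w), (w, v)} \<subseteq> E'" using vw assms(4) e'(2) by (auto dest: symD)
  then have "merge E v w \<subseteq> E'" using e'(3) by (metis trancl_id trancl_mono_subset)
  moreover have eqm: "equiv S (merge E v w)" using equiv_merge assms(2) S by blast
  moreover have "finite (S // merge E v w)"
    using assms(1) eqm by (auto intro: finite_quotient elim: equivE)
  ultimately have "card (S // E') \<le> card (S // merge E v w)"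
    using finite_refines_card_le assms(3) by blast
  then show ?thesis using card_merge[OF assms(1,2) S vw(2)] by simp
qed

section \<open>Distances in the Hasse diagram\<close>

definition rel_of :: "nat set set \<Rightarrow> nat rel" where
  "rel_of \<pi> = {(x, y). \<exists>p\<in>\<pi>. x \<in> p \<and> y \<in> p}"

lemma noncrossing_iff_nc_rel:
  assumes "partition_on A \<pi>"
  shows "noncrossing \<pi> \<longleftrightarrow> nc_rel (rel_of \<pi>)"
proof -
  have eq: "equiv A (rel_of \<pi>)"
    using equiv_partition_on[OF assms] by (simp add: rel_of_def)
  have disj: "V = W" if "V \<in> \<pi>" "W \<in> \<pi>" "x \<in> V" "x \<in> W" for V W x
    using that assms by (auto simp: partition_on_def disjoint_def)
  show ?thesis
    unfolding nc_rel_iff[OF eq]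
  proof
    assume nc: "noncrossing \<pi>"
    show "\<forall>a b c d. a < b \<longrightarrow> b < c \<longrightarrow> c < d \<longrightarrow> (a, c) \<in> rel_of \<pi> \<longrightarrow> (b, d) \<in> rel_of \<pi> \<longrightarrow> (a, b) \<in> rel_of \<pi>"
    proof (intro allI impI)
      fix a b c d assume lt: "a < b" "b < c" "c < d" and "(a, c) \<in> rel_of \<pi>" "(b, d) \<in> rel_of \<pi>"
      then obtain V W where VW: "V \<in> \<pi>" "W \<in> \<pi>" "a \<in> V" "c \<in> V" "b \<in> W" "d \<in> W"
        by (auto simp: rel_of_def)
      then have "V = W" using nc lt unfolding noncrossing_def by blast
      then show "(a, b) \<in> rel_of \<pi>" using VW by (auto simp: rel_of_def)
    qed
  next
    assume R: "\<forall>a b c d. a < b \<longrightarrow> b < c \<longrightarrow> c < d \<longrightarrow> (a, c) \<in> rel_of \<pi> \<longrightarrow> (b, d) \<in> rel_of \<pi> \<longrightarrow> (a, b) \<in> rel_of \<pi>"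
    show "noncrossing \<pi>"
      unfolding noncrossing_def
    proof (rule notI, elim bexE exE conjE)
      fix V W a b c d
      assume VW: "V \<in> \<pi>" "W \<in> \<pi>" "V \<noteq> W" and lt: "a < b" "b < c" "c < d"
        and i: "a \<in> V" "c \<in> V" "b \<in> W" "d \<in> W"
      have "(a, c) \<in> rel_of \<pi>" "(b, d) \<in> rel_of \<pi>" using VW i by (auto simp: rel_of_def)
      then have "(a, b) \<in> rel_of \<pi>" using R lt by blast
      then obtain U where "U \<in> \<pi>" "a \<in> U" "b \<in> U" by (auto simp: rel_of_def)
      then have "V = W" using disj VW i by metis
      then show False using VW by simp
    qed
  qed
qed

lemma rel_of_quotient:
  assumes "equiv A E"
  shows "rel_of (A // E) = E"
proof -
  have "(x, y) \<in> rel_of (A // E) \<longleftrightarrow> (x, y) \<in> E" for x y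
  proof
    assume "(x, y) \<in> rel_of (A // E)"
    then obtain z where "(z, x) \<in> E" "(z, y) \<in> E" by (auto simp: rel_of_def elim!: quotientE)
    then show "(x, y) \<in> E" using assms by (meson equivE symD transD)
  next
    assume xy: "(x, y) \<in> E"
    then have x: "x \<in> A" using assms by (auto elim: equivE)
    then have "E `` {x} \<in> A // E" "x \<in> E `` {x}" using equiv_class_self[OF assms x] x by (auto intro: quotientI)
    then show "(x, y) \<in> rel_of (A // E)" using xy unfolding rel_of_def by blast
  qed
  then show ?thesis by auto
qed

lemma NC_rel_of:
  assumes "\<pi> \<in> NC n"
  shows rel_of_in_ncr: "rel_of \<pi> \<in> ncr {1..n}"
    and quotient_rel_of: "{1..n} // rel_of \<pi> = \<pi>"
  using assms equiv_partition_on[of "{1..n}" \<pi>] partition_on_eq_quotient[of "{1..n}" \<pi>]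
  by (auto simp: NC_def ncr_def noncrossing_iff_nc_rel rel_of_def[symmetric])

lemma quotient_in_NC:
  assumes "E \<in> ncr {1..n}"
  shows "{1..n} // E \<in> NC n"
proof -
  have E: "equiv {1..n} E" using assms by (simp add: ncr_def)
  then have "partition_on {1..n} ({1..n} // E)" by (rule partition_on_quotient)
  then show ?thesis
    using noncrossing_iff_nc_rel rel_of_quotient[OF E] assms by (auto simp: NC_def ncr_def)
qed

lemma bij_betw_rel_of: "bij_betw rel_of (NC n) (ncr {1..n})"
  by (rule bij_betw_byWitness[where f' = "\<lambda>E. {1..n} // E"])
    (use quotient_rel_of rel_of_in_ncr quotient_in_NC rel_of_quotient in \<open>auto simp: ncr_def simp del: atLeastAtMost_iff One_nat_def\<close>)

lemma nc_less_iff: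
  "nc_less n \<pi> \<rho> \<longleftrightarrow> \<pi> \<in> NC n \<and> \<rho> \<in> NC n \<and> rel_of \<pi> \<subset> rel_of \<rho>"
proof -
  have "refines {1..n} \<pi> \<rho> \<longleftrightarrow> rel_of \<pi> \<subseteq> rel_of \<rho>" if "\<pi> \<in> NC n" "\<rho> \<in> NC n"
  proof -
    have P: "partition_on {1..n} \<pi>" "partition_on {1..n} \<rho>" using that by (auto simp: NC_def)
    show ?thesis
    proof
      assume "refines {1..n} \<pi> \<rho>"
      then have ref: "\<exists>Y\<in>\<rho>. X \<subseteq> Y" if "X \<in> \<pi>" for X using that by (simp add: refines_def)
      show "rel_of \<pi> \<subseteq> rel_of \<rho>"
      proof
        fix p assume "p \<in> rel_of \<pi>"
        then obtain x y X where X: "p = (x, y)" "X \<in> \<pi>" "x \<in> X" "y \<in> X" by (auto simp: rel_of_def)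
        then obtain Y where "Y \<in> \<rho>" "X \<subseteq> Y" using ref by blast
        then show "p \<in> rel_of \<rho>" using X by (auto simp: rel_of_def)
      qed
    next
      assume sub: "rel_of \<pi> \<subseteq> rel_of \<rho>"
      have "\<exists>Y\<in>\<rho>. X \<subseteq> Y" if X: "X \<in> \<pi>" for X
      proof -
        obtain x where x: "x \<in> X" using X P(1) by (metis all_not_in_conv partition_onD3)
        then have "(x, x) \<in> rel_of \<rho>" using sub X by (auto simp: rel_of_def)
        then obtain Y where Y: "Y \<in> \<rho>" "x \<in> Y" by (auto simp: rel_of_def)
        have "y \<in> Y" if "y \<in> X" for y
        proof -
          have "(x, y) \<in> rel_of \<rho>" using sub X x that by (auto simp: rel_of_def)
          then obtain Z where "Z \<in> \<rho>" "x \<in> Z" "y \<in> Z" by (auto simp: rel_of_def)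
          then show ?thesis using Y P(2) by (metis partition_onD2 disjointD disjoint_iff)
        qed
        then show ?thesis using Y by blast
      qed
      then show "refines {1..n} \<pi> \<rho>" using P by (simp add: refines_def)
    qed
  qed
  moreover have "\<pi> = \<rho> \<longleftrightarrow> rel_of \<pi> = rel_of \<rho>" if "\<pi> \<in> NC n" "\<rho> \<in> NC n"
    using that quotient_rel_of by metis
  ultimately show ?thesis unfolding nc_less_def by blast
qed

text \<open>\<open>ncr_merge_between\<close> puts a merge above \<open>\<pi>\<close> and below
  \<open>\<rho>\<close>; a cover leaves no room for it to differ from \<open>\<rho>\<close>.\<close>

lemma nc_covers_imp_merge:
  assumes "nc_covers n \<rho> \<pi>"
  obtains v w where "v \<in> {1..n}" "w \<in> {1..n}" "(v, w) \<notin> rel_of \<pi>" "rel_of \<rho> = merge (rel_of \<pi>) v w"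
proof -
  have less: "\<pi> \<in> NC n" "\<rho> \<in> NC n" "rel_of \<pi> \<subset> rel_of \<rho>"
    using assms by (auto simp: nc_covers_def nc_less_iff)
  from ncr_merge_between[OF rel_of_in_ncr[OF less(1)] rel_of_in_ncr[OF less(2)] less(3)]
  obtain v w where vw: "(v, w) \<in> rel_of \<rho> - rel_of \<pi>" "merge (rel_of \<pi>) v w \<in> ncr {1..n}"
    "merge (rel_of \<pi>) v w \<subseteq> rel_of \<rho>" by blast
  let ?E = "merge (rel_of \<pi>) v w"
  have r: "rel_of ({1..n} // ?E) = ?E" using vw(2) by (intro rel_of_quotient) (simp add: ncr_def)
  have "(v, w) \<in> ?E" "rel_of \<pi> \<subseteq> ?E" by auto
  then have "nc_less n \<pi> ({1..n} // ?E)"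
    unfolding nc_less_iff r using less quotient_in_NC[OF vw(2)] vw(1) by blast
  then have "\<not> nc_less n ({1..n} // ?E) \<rho>"
    using assms by (auto simp: nc_covers_def)
  then have "?E = rel_of \<rho>"
    unfolding nc_less_iff r using less quotient_in_NC[OF vw(2)] vw(3) by blast
  moreover have "rel_of \<rho> \<subseteq> {1..n} \<times> {1..n}"
    using rel_of_in_ncr[OF less(2)] by (auto simp: ncr_def elim: equivE)
  ultimately show ?thesis using that[of v w] vw(1) by blast
qed

lemma nc_less_card:
  assumes "nc_less n \<pi> \<rho>"
  shows "card \<rho> < card \<pi>"
proof -
  have "\<pi> \<in> NC n" "\<rho> \<in> NC n" "rel_of \<pi> \<subset> rel_of \<rho>" using assms by (auto simp: nc_less_iff)
  then show ?thesis
    using card_quotient_less[of "{1..n}" "rel_of \<pi>" "rel_of \<rho>"] rel_of_in_ncr[of _ n] quotient_rel_of[of _ n]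
    by (simp add: ncr_def)
qed

text \<open>A single merge towards \<open>\<rho>\<close> is a cover: it lowers the number of blocks
  by exactly one, while anything strictly between would need a number of blocks strictly
  between.\<close>

lemma nc_covers_below:
  assumes "nc_less n \<pi> \<rho>"
  obtains \<tau> where "nc_covers n \<tau> \<pi>" "\<tau> = \<rho> \<or> nc_less n \<tau> \<rho>" "card \<pi> = Suc (card \<tau>)"
proof -
  have less: "\<pi> \<in> NC n" "\<rho> \<in> NC n" "rel_of \<pi> \<subset> rel_of \<rho>"
    using assms by (auto simp: nc_less_iff)
  from ncr_merge_between[OF rel_of_in_ncr[OF less(1)] rel_of_in_ncr[OF less(2)] less(3)]
  obtain v w where vw: "(v, w) \<in> rel_of \<rho> - rel_of \<pi>" "merge (rel_of \<pi>) v w \<in> ncr {1..n}"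
    "merge (rel_of \<pi>) v w \<subseteq> rel_of \<rho>" by blast
  let ?E = "merge (rel_of \<pi>) v w"
  have r: "rel_of ({1..n} // ?E) = ?E" using vw(2) by (intro rel_of_quotient) (simp add: ncr_def)
  have S: "v \<in> {1..n}" "w \<in> {1..n}"
    using equiv_type[of "{1..n}" "rel_of \<rho>"] rel_of_in_ncr[OF less(2)] vw(1) unfolding ncr_def by blast+
  have c: "card \<pi> = Suc (card ({1..n} // ?E))"
    using card_merge[of "{1..n}" "rel_of \<pi>" v w] S vw(1) rel_of_in_ncr[OF less(1)] quotient_rel_of[OF less(1)]
    by (simp add: ncr_def)
  have "(v, w) \<in> ?E" "rel_of \<pi> \<subseteq> ?E" by auto
  then have l: "nc_less n \<pi> ({1..n} // ?E)"
    unfolding nc_less_iff r using less quotient_in_NC[OF vw(2)] vw(1) by blast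
  have "nc_covers n ({1..n} // ?E) \<pi>"
    unfolding nc_covers_def
  proof (intro conjI notI l)
    assume "\<exists>\<sigma>. nc_less n \<pi> \<sigma> \<and> nc_less n \<sigma> ({1..n} // ?E)"
    then obtain \<sigma> :: "nat set set" where "card \<sigma> < card \<pi>" "card ({1..n} // ?E) < card \<sigma>"
      using nc_less_card by blast
    then show False using c by linarith
  qed
  moreover have "{1..n} // ?E = \<rho> \<or> nc_less n ({1..n} // ?E) \<rho>"
  proof (cases "?E = rel_of \<rho>")
    case True then show ?thesis using quotient_rel_of[OF less(2)] by simp
  next
    case False
    then show ?thesis unfolding nc_less_iff r using less quotient_in_NC[OF vw(2)] vw(3) by blast
  qed
  ultimately show ?thesis using that c by blast
qed

section \<open>Walks and the distance formula\<close>

lemma hasse_simps [simp]: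
  "verts (hasse n) = NC n"
  "arcs (hasse n) = {(\<pi>, \<rho>). nc_covers n \<pi> \<rho> \<or> nc_covers n \<rho> \<pi>}"
  "tail (hasse n) = fst" "head (hasse n) = snd"
  by (simp_all add: hasse_def)

lemma d_H_le_walk:
  assumes "pre_digraph.awalk (hasse n) \<pi> p \<rho>"
  shows "d_H n \<pi> \<rho> \<le> length p"
proof -
  interpret wf_digraph "hasse n" by (rule wf_digraph_hasse)
  have "\<pi> \<in> NC n" "\<rho> \<in> NC n" using assms by (auto dest: awalkI_apath awalk_hd_in_verts awalk_last_in_verts)
  then have "ereal (d_H n \<pi> \<rho>) = \<mu> (\<lambda>_. 1) \<pi> \<rho>" by (rule ereal_d_H)
  also have "\<dots> \<le> ereal (awalk_cost (\<lambda>_. 1) p)" using assms by (rule min_cost_le_walk_cost)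
  also have "awalk_cost (\<lambda>_. 1) p = length p" by (simp add: awalk_cost_def sum_list_triv)
  finally show ?thesis by simp
qed

lemma d_H_ge_walk:
  fixes c :: real
  assumes "\<pi> \<in> NC n" "\<rho> \<in> NC n" "\<And>p. pre_digraph.awalk (hasse n) \<pi> p \<rho> \<Longrightarrow> c \<le> length p"
  shows "c \<le> d_H n \<pi> \<rho>"
proof -
  interpret wf_digraph "hasse n" by (rule wf_digraph_hasse)
  have "ereal c \<le> \<mu> (\<lambda>_. 1) \<pi> \<rho>"
    unfolding \<mu>_def using assms(3) by (intro INF_greatest) (auto simp: awalk_cost_def sum_list_triv)
  then show ?thesis using ereal_d_H[OF assms(1,2)] by (metis ereal_less_eq(3))
qed

text \<open>A saturated chain loses one block per edge. Both directions are provided because the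
  walk through the join climbs from \<open>\<Lambda>\<close> and then descends to
  \<open>\<rho>\<close>.\<close>

lemma walks_of_nc_less:
  assumes "\<pi> \<in> NC n" "\<pi> = \<rho> \<or> nc_less n \<pi> \<rho>"
  shows "\<exists>p q. pre_digraph.awalk (hasse n) \<pi> p \<rho> \<and> pre_digraph.awalk (hasse n) \<rho> q \<pi> \<and>
    length p + card \<rho> = card \<pi> \<and> length q + card \<rho> = card \<pi>"
  using assms
proof (induction "card \<pi>" arbitrary: \<pi> rule: less_induct)
  case less
  interpret wf_digraph "hasse n" by (rule wf_digraph_hasse)
  show ?case
  proof (cases "\<pi> = \<rho>")
    case True
    then show ?thesis using less.prems(1) by (intro exI[of _ "[]"]) (simp add: awalk_Nil_iff)
  next
    case False
    then obtain \<tau> where \<tau>: "nc_covers n \<tau> \<pi>" "\<tau> = \<rho> \<or> nc_less n \<tau> \<rho>" "card \<pi> = Suc (card \<tau>)"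
      using nc_covers_below less.prems by blast
    have "\<tau> \<in> NC n" using \<tau>(1) by (simp add: nc_covers_def nc_less_def)
    then obtain p q where pq: "awalk \<tau> p \<rho>" "awalk \<rho> q \<tau>" "length p + card \<rho> = card \<tau>" "length q + card \<rho> = card \<tau>"
      using less.hyps[of \<tau>] \<tau>(2,3) by auto
    have "awalk \<pi> ((\<pi>, \<tau>) # p) \<rho>" using pq(1) \<tau>(1) by (simp add: awalk_Cons_iff)
    moreover have "awalk \<tau> [(\<tau>, \<pi>)] \<pi>" using \<tau>(1) less.prems(1) by (simp add: awalk_Cons_iff awalk_Nil_iff)
    then have "awalk \<rho> (q @ [(\<tau>, \<pi>)]) \<pi>" using pq(2) by (rule awalk_appendI[rotated])
    ultimately show ?thesis using pq(3,4) \<tau>(3)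
      by (intro exI[of _ "(\<pi>, \<tau>) # p"] exI[of _ "q @ [(\<tau>, \<pi>)]"]) simp
  qed
qed

text \<open>Upper bound: walk through the join, which is noncrossing since the blocks of \<open>\<Lambda>\<close> are intervals.
  Lower bound: \<open>card \<sigma> - 2 card (\<sigma> \<squnion> \<Lambda>)\<close> changes by at most 1 along an edge.\<close>

theorem d_H_interval_partition:
  assumes \<Lambda>: "\<Lambda> \<in> NC n" and \<rho>: "\<rho> \<in> NC n"
    and conv: "\<And>v w z. (v, w) \<in> rel_of \<Lambda> \<Longrightarrow> z \<in> {1..n} \<Longrightarrow> v \<le> z \<Longrightarrow> z \<le> w \<Longrightarrow> (v, z) \<in> rel_of \<Lambda>"
  shows "d_H n \<Lambda> \<rho> = real (card \<Lambda>) + real (card \<rho>) - 2 * real (card ({1..n} // (rel_of \<rho> \<union> rel_of \<Lambda>)\<^sup>+))"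
proof (rule antisym)
  interpret wf_digraph "hasse n" by (rule wf_digraph_hasse)
  let ?S = "{1..n}"
  let ?L = "rel_of \<Lambda>"
  let ?J = "\<lambda>\<sigma>. (rel_of \<sigma> \<union> ?L)\<^sup>+"
  let ?c = "\<lambda>\<sigma>. card (?S // ?J \<sigma>)"
  define f where "f \<sigma> = real (card \<sigma>) - 2 * real (?c \<sigma>)" for \<sigma>
  have L: "equiv ?S ?L" using rel_of_in_ncr[OF \<Lambda>] by (simp add: ncr_def)
  then have L': "?L \<subseteq> ?S \<times> ?S" "sym ?L" "trans ?L" by (auto elim: equivE)
  have eqJ: "equiv ?S (?J \<sigma>)" if "\<sigma> \<in> NC n" for \<sigma>
    using rel_of_in_ncr[OF that] L'(1,2) by (intro equiv_trancl) (auto simp: ncr_def)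
  have J\<rho>: "?J \<rho> \<in> ncr ?S"
    using rel_of_in_ncr[OF \<rho>] L conv by (rule ncr_join_convex)
  define \<sigma> where "\<sigma> = ?S // ?J \<rho>"
  have \<sigma>: "\<sigma> \<in> NC n" and rel\<sigma>: "rel_of \<sigma> = ?J \<rho>"
    using quotient_in_NC[OF J\<rho>] rel_of_quotient J\<rho> unfolding \<sigma>_def ncr_def by blast+
  have "?L \<subseteq> rel_of \<sigma>" "rel_of \<rho> \<subseteq> rel_of \<sigma>" unfolding rel\<sigma> by auto
  then have "\<Lambda> = \<sigma> \<or> nc_less n \<Lambda> \<sigma>" "\<rho> = \<sigma> \<or> nc_less n \<rho> \<sigma>"
    using \<sigma> \<rho> \<Lambda> quotient_rel_of unfolding nc_less_iff by (metis psubsetI)+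
  then obtain p q where "awalk \<Lambda> p \<sigma>" "length p + card \<sigma> = card \<Lambda>"
     "awalk \<sigma> q \<rho>" "length q + card \<sigma> = card \<rho>"
    using walks_of_nc_less[OF \<Lambda>] walks_of_nc_less[OF \<rho>] by metis
  then have "awalk \<Lambda> (p @ q) \<rho>" "real (length (p @ q)) = card \<Lambda> + card \<rho> - 2 * real (card \<sigma>)"
    by (auto intro: awalk_appendI)
  then show "d_H n \<Lambda> \<rho> \<le> real (card \<Lambda>) + real (card \<rho>) - 2 * real (?c \<rho>)"
    using d_H_le_walk[of n \<Lambda> "p @ q" \<rho>] unfolding \<sigma>_def by simp
  \<comment> \<open>A cover removes one block, while the join loses one class or none; the weight 2
    makes the change of \<open>f\<close> either +1 or -1.\<close>
  have up: "\<bar>f \<tau> - f \<sigma>\<bar> \<le> 1" if cov: "nc_covers n \<tau> \<sigma>" for \<sigma> \<tau>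
  proof -
    have NC: "\<sigma> \<in> NC n" "\<tau> \<in> NC n" using cov by (auto simp: nc_covers_def nc_less_def)
    obtain v w where vw: "v \<in> ?S" "w \<in> ?S" "(v, w) \<notin> rel_of \<sigma>" "rel_of \<tau> = merge (rel_of \<sigma>) v w"
      by (rule nc_covers_imp_merge[OF cov])
    have "card \<sigma> = Suc (card \<tau>)"
      using card_merge[of ?S "rel_of \<sigma>" v w, folded vw(4)] vw(1-3) rel_of_in_ncr[OF NC(1)]
      unfolding quotient_rel_of[OF NC(1)] quotient_rel_of[OF NC(2)] by (simp add: ncr_def)
    moreover have "?J \<tau> = merge (?J \<sigma>) v w" unfolding vw(4) by (rule merge_Un)
    then have "?c \<sigma> = ?c \<tau> \<or> ?c \<sigma> = Suc (?c \<tau>)"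
      using card_merge[of ?S "?J \<sigma>" v w] merge_same[of ?S "?J \<sigma>" v w] eqJ[OF NC(1)] vw(1,2) by fastforce
    ultimately show ?thesis by (auto simp: f_def)
  qed
  have lip: "\<bar>f v - f u\<bar> \<le> length p" if "awalk u p v" for u p v
    using that
  proof (induction p arbitrary: u)
    case Nil
    then show ?case by (simp add: awalk_Nil_iff)
  next
    case (Cons e p)
    obtain a b where e: "e = (a, b)" by (cases e)
    have "\<bar>f v - f b\<bar> \<le> length p" "u = a" "nc_covers n a b \<or> nc_covers n b a"
      using Cons e by (auto simp: awalk_Cons_iff)
    moreover from this(3) have "\<bar>f b - f a\<bar> \<le> 1" using up[of a b] up[of b a] by auto
    ultimately show ?case by simp
  qed
  \<comment> \<open>The join of \<open>\<Lambda>\<close> with itself is \<open>\<Lambda>\<close>, so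
    the potential starts at \<open>card \<Lambda> - 2 * card \<Lambda>\<close>.\<close>
  have "?J \<Lambda> = ?L" using L'(3) by simp
  then have "f \<Lambda> = - real (card \<Lambda>)" using quotient_rel_of[OF \<Lambda>] by (simp add: f_def)
  then have "real (card \<Lambda>) + real (card \<rho>) - 2 * real (?c \<rho>) = f \<rho> - f \<Lambda>" by (simp add: f_def)
  also have "\<dots> \<le> d_H n \<Lambda> \<rho>"
  proof (rule d_H_ge_walk[OF \<Lambda> \<rho>])
    fix p assume "awalk \<Lambda> p \<rho>"
    then show "f \<rho> - f \<Lambda> \<le> length p" using lip by (meson abs_le_D1)
  qed
  finally show "real (card \<Lambda>) + real (card \<rho>) - 2 * real (?c \<rho>) \<le> d_H n \<Lambda> \<rho>" .
qed

text \<open>The truncated \<open>x - 1\<close> is harmless: all ground sets consist of positive numbers.\<close>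

definition interval_blocks :: "nat \<Rightarrow> nat set \<Rightarrow> nat rel" where
  "interval_blocks q S = {(x, y) \<in> S \<times> S. (x - 1) div q = (y - 1) div q}"

abbreviation join_blocks :: "nat \<Rightarrow> nat set \<Rightarrow> nat rel \<Rightarrow> nat rel" where
  "join_blocks q S E \<equiv> (E \<union> interval_blocks q S)\<^sup>+"

lemma equiv_interval_blocks: "equiv S (interval_blocks q S)"
  by (auto intro!: equivI refl_onI symI transI simp: interval_blocks_def)

lemma interval_blocks_convex:
  assumes "(v, w) \<in> interval_blocks q S" "z \<in> S" "v \<le> z" "z \<le> w"
  shows "(v, z) \<in> interval_blocks q S"
proof -
  have "(v - 1) div q \<le> (z - 1) div q" "(z - 1) div q \<le> (w - 1) div q"
    using assms by (auto intro!: div_le_mono)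
  then show ?thesis using assms by (auto simp: interval_blocks_def)
qed

lemma rel_of_lambda2: "rel_of (lambda2 m) = interval_blocks 2 {1..2 * m}"
proof -
  have "(x, y) \<in> rel_of (lambda2 m) \<longleftrightarrow> (x, y) \<in> interval_blocks 2 {1..2 * m}" for x y
  proof
    assume "(x, y) \<in> rel_of (lambda2 m)"
    then obtain i where "i \<in> {1..m}" "x \<in> {2 * i - 1, 2 * i}" "y \<in> {2 * i - 1, 2 * i}"
      by (auto simp: rel_of_def lambda2_def)
    moreover have "(2 * i - 1 - 1) div 2 = i - 1" "(2 * i - 1) div 2 = i - 1" if "1 \<le> i" for i :: nat
      using that by (cases i; simp)+
    ultimately show "(x, y) \<in> interval_blocks 2 {1..2 * m}"
      by (auto simp: interval_blocks_def)
  next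
    assume "(x, y) \<in> interval_blocks 2 {1..2 * m}"
    then have "x \<in> {1..2*m}" "y \<in> {1..2*m}" "(x - 1) div 2 = (y - 1) div 2"
      by (auto simp: interval_blocks_def)
    note xy = this
    define i where "i = (x - 1) div 2 + 1"
    have *: "z = 2 * i - 1 \<or> z = 2 * i" if "1 \<le> z" "(z - 1) div 2 = i - 1" for z
    proof -
      have "z - 1 = 2 * ((z - 1) div 2) + (z - 1) mod 2" by simp
      then have "z - 1 = 2 * (i - 1) + (z - 1) mod 2" unfolding that(2) .
      moreover have "(z - 1) mod 2 = 0 \<or> (z - 1) mod 2 = 1" by auto
      moreover have "1 \<le> i" by (simp add: i_def)
      ultimately show ?thesis using that(1) by auto
    qed
    have x: "x = 2 * i - 1 \<or> x = 2 * i" and y: "y = 2 * i - 1 \<or> y = 2 * i"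
      using xy by (auto intro!: * simp: i_def)
    moreover have "1 \<le> i" by (simp add: i_def)
    ultimately have "i \<in> {1..m}" "x \<in> {2 * i - 1, 2 * i}" "y \<in> {2 * i - 1, 2 * i}"
      using xy(1) by auto
    then show "(x, y) \<in> rel_of (lambda2 m)" unfolding rel_of_def lambda2_def by blast
  qed
  then show ?thesis by auto
qed

lemma card_lambda2: "card (lambda2 m) = m"
proof -
  have "inj_on (\<lambda>i. {2 * i - 1, 2 * i}) {1..m}"
    by (auto simp: inj_on_def doubleton_eq_iff)
  then show ?thesis unfolding lambda2_def by (simp add: card_image)
qed

lemma d_H_lambda2:
  assumes "\<rho> \<in> NC (2 * m)"
  shows "d_H (2 * m) (lambda2 m) \<rho> =
    real m + real (card \<rho>) - 2 * real (card ({1..2 * m} // join_blocks 2 {1..2 * m} (rel_of \<rho>)))"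
  using d_H_interval_partition[OF lambda2_in_NC assms] interval_blocks_convex
  by (simp add: rel_of_lambda2 card_lambda2)

section \<open>Counting by components of the join\<close>

lemma ncrD:
  assumes "E \<in> ncr S"
  shows ncr_equiv: "equiv S E"
    and ncr_sub: "E \<subseteq> S \<times> S"
    and ncr_refl: "x \<in> S \<Longrightarrow> (x, x) \<in> E"
    and ncr_sym: "(x, y) \<in> E \<Longrightarrow> (y, x) \<in> E"
    and ncr_trans: "(x, y) \<in> E \<Longrightarrow> (y, z) \<in> E \<Longrightarrow> (x, z) \<in> E"
    and ncr_nc: "nc_rel E"
proof -
  have "equiv S E" "nc_rel E" using assms by (auto simp: ncr_def)
  moreover from this have "E \<subseteq> S \<times> S" "refl_on S E" "sym E" "trans E" by (auto elim: equivE)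
  ultimately show "equiv S E" "E \<subseteq> S \<times> S" "x \<in> S \<Longrightarrow> (x, x) \<in> E" "(x, y) \<in> E \<Longrightarrow> (y, x) \<in> E"
    "(x, y) \<in> E \<Longrightarrow> (y, z) \<in> E \<Longrightarrow> (x, z) \<in> E" "nc_rel E"
    by (auto simp: refl_on_def dest: symD transD)
qed

lemma ncrI:
  assumes "E \<subseteq> S \<times> S" "\<And>x. x \<in> S \<Longrightarrow> (x, x) \<in> E" "\<And>x y. (x, y) \<in> E \<Longrightarrow> (y, x) \<in> E"
    "\<And>x y z. (x, y) \<in> E \<Longrightarrow> (y, z) \<in> E \<Longrightarrow> (x, z) \<in> E"
    "\<And>x y u v. (x, y) \<in> E \<Longrightarrow> (u, v) \<in> E \<Longrightarrow> (x, u) \<notin> E \<Longrightarrow>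
      ((x < u) = (y < u)) = ((x < v) = (y < v))"
  shows "E \<in> ncr S"
  unfolding ncr_def nc_rel_def equiv_def refl_on_def sym_def trans_def using assms by blast

lemma finite_ncr: "finite S \<Longrightarrow> finite (ncr S)"
  by (rule finite_subset[of _ "Pow (S \<times> S)"]) (auto dest: ncr_sub)

section \<open>Relabelling along monotone maps\<close>

abbreviation rmap :: "(nat \<Rightarrow> nat) \<Rightarrow> nat rel \<Rightarrow> nat rel" where
  "rmap f E \<equiv> map_prod f f ` E"

lemma rmap_in_ncr:
  assumes f: "strict_mono_on S f" and E: "E \<in> ncr S"
  shows "rmap f E \<in> ncr (f ` S)"
proof (rule ncrI)
  have less: "f x < f y \<longleftrightarrow> x < y" if "x \<in> S" "y \<in> S" for x y
    using f that by (simp add: strict_mono_on_less)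
  have inj: "x = y" if "f x = f y" "x \<in> S" "y \<in> S" for x y
    using f that by (meson inj_onD strict_mono_on_imp_inj_on)
  note S = ncr_sub[OF E]
  show "rmap f E \<subseteq> f ` S \<times> f ` S" using S by auto
  show "(x, x) \<in> rmap f E" if "x \<in> f ` S" for x using that ncr_refl[OF E] by force
  show "(y, x) \<in> rmap f E" if "(x, y) \<in> rmap f E" for x y using that ncr_sym[OF E] by force
  show "(x, z) \<in> rmap f E" if xy: "(x, y) \<in> rmap f E" and yz: "(y, z) \<in> rmap f E" for x y z
  proof -
    obtain a b where ab: "x = f a" "y = f b" "(a, b) \<in> E" using xy by auto
    obtain c d where cd: "y = f c" "z = f d" "(c, d) \<in> E" using yz by auto
    have "b = c" using ab cd inj S by auto
    then have "(a, d) \<in> E" using ab cd ncr_trans[OF E] by blast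
    then show ?thesis using ab cd by force
  qed
  show "((x < u) = (y < u)) = ((x < v) = (y < v))"
    if xy: "(x, y) \<in> rmap f E" and uv: "(u, v) \<in> rmap f E" and n: "(x, u) \<notin> rmap f E" for x y u v
  proof -
    obtain a b where ab: "x = f a" "y = f b" "(a, b) \<in> E" using xy by auto
    obtain c d where cd: "u = f c" "v = f d" "(c, d) \<in> E" using uv by auto
    have mem: "a \<in> S" "b \<in> S" "c \<in> S" "d \<in> S" using ab(3) cd(3) S by auto
    have "(a, c) \<notin> E" using n ab cd by force
    from nc_relD[OF ncr_nc[OF E] ab(3) cd(3) this] show ?thesis
      using mem by (simp add: ab cd less)
  qed
qed

lemma rmap_inv_into:
  assumes "inj_on f S" "E \<subseteq> S \<times> S"
  shows "rmap (inv_into S f) (rmap f E) = E"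
proof -
  have "rmap (inv_into S f) (rmap f E) = (\<lambda>p. p) ` E"
    unfolding image_image using assms by (intro image_cong) (auto simp: inv_into_f_f)
  then show ?thesis by simp
qed

lemma rmap_inv_into2:
  assumes "E \<subseteq> f ` S \<times> f ` S"
  shows "rmap f (rmap (inv_into S f) E) = E"
proof -
  have "rmap f (rmap (inv_into S f) E) = (\<lambda>p. p) ` E"
    unfolding image_image using assms by (intro image_cong) (auto simp: f_inv_into_f)
  then show ?thesis by simp
qed

text \<open>Noncrossing relations depend only on the order type of the ground set; this serves both
  translated intervals and an interval whose gap is closed.\<close>

lemma bij_betw_rmap:
  assumes f: "strict_mono_on S f"
  shows "bij_betw (rmap f) (ncr S) (ncr (f ` S))"
proof (rule bij_betw_byWitness[where f' = "rmap (inv_into S f)"])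
  have inj: "inj_on f S" using f by (rule strict_mono_on_imp_inj_on)
  have "strict_mono_on (f ` S) (inv_into S f)"
    using f inj by (auto intro!: strict_mono_onI simp: strict_mono_on_less)
  from rmap_in_ncr[OF this] have "rmap (inv_into S f) E \<in> ncr S" if "E \<in> ncr (f ` S)" for E
    using that inj by (simp add: inv_into_image_cancel)
  then show "rmap (inv_into S f) ` ncr (f ` S) \<subseteq> ncr S" by blast
  show "\<forall>E\<in>ncr S. rmap (inv_into S f) (rmap f E) = E"
    by (intro ballI rmap_inv_into[OF inj] ncr_sub)
  show "\<forall>E\<in>ncr (f ` S). rmap f (rmap (inv_into S f) E) = E"
    by (intro ballI rmap_inv_into2 ncr_sub)
  show "rmap f ` ncr S \<subseteq> ncr (f ` S)" using rmap_in_ncr[OF f] by blast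
qed

lemma rmap_trancl:
  assumes "inj_on f S" "G \<subseteq> S \<times> S" "a \<in> S" "b \<in> S"
  shows "(f a, f b) \<in> (rmap f G)\<^sup>+ \<longleftrightarrow> (a, b) \<in> G\<^sup>+"
proof -
  have *: "(h x, h y) \<in> (rmap h H)\<^sup>+" if "(x, y) \<in> H\<^sup>+" for x y H and h :: "nat \<Rightarrow> nat"
    using that
  proof (induction rule: trancl_induct)
    case (base y)
    then have "(h x, h y) \<in> rmap h H" by force
    then show ?case by (rule r_into_trancl')
  next
    case (step y z)
    then have "(h y, h z) \<in> rmap h H" by force
    then show ?case using step.IH by (meson trancl_into_trancl)
  qed
  show ?thesis
  proof
    assume "(f a, f b) \<in> (rmap f G)\<^sup>+"
    from *[OF this, of "inv_into S f"] show "(a, b) \<in> G\<^sup>+"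
      using assms by (simp add: rmap_inv_into)
  qed (rule *)
qed

text \<open>The ground set is half-open so that translates and cuts at multiples of \<open>q\<close>
  carry no correction by one.\<close>

definition nc_count :: "nat \<Rightarrow> nat" where
  "nc_count n = card (ncr {0<..n})"

text \<open>These are the coefficients of the series \<open>A\<close> for block length
  \<open>q\<close>.\<close>

definition conn_count :: "nat \<Rightarrow> nat \<Rightarrow> nat" where
  "conn_count q k = card {E \<in> ncr {0<..q * k}. (1, q * k) \<in> join_blocks q {0<..q * k} E}"

text \<open>The offset is a multiple of \<open>q\<close>, so the translation maps blocks of length
  \<open>q\<close> onto such blocks and commutes with forming the join.\<close>

lemma card_ncr_shift_conn:
  assumes "q \<ge> 1" "k \<ge> 1"
  shows "card {E \<in> ncr {q * i<..q * (i + k)}.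
      (q * i + 1, q * (i + k)) \<in> join_blocks q {q * i<..q * (i + k)} E} = conn_count q k"
proof -
  let ?f = "\<lambda>x. q * i + x" and ?S = "{0<..q * k}" and ?T = "{q * i<..q * (i + k)}"
  have mono: "strict_mono_on ?S ?f" by (auto intro!: strict_mono_onI)
  then have inj: "inj_on ?f ?S" by (rule strict_mono_on_imp_inj_on)
  have img: "?f ` ?S = ?T"
    using image_add_greaterThanAtMost[of "q * i" 0 "q * k"] by (simp add: distrib_left)
  have sh: "(q * i + x - 1) div q = i + (x - 1) div q" if "0 < x" for x
  proof -
    have "q * i + x - 1 = x - 1 + q * i" using that by simp
    then show ?thesis using assms(1) by simp
  qed
  have blk: "rmap ?f (interval_blocks q ?S) = interval_blocks q ?T"
  proof
    show "rmap ?f (interval_blocks q ?S) \<subseteq> interval_blocks q ?T"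
      using sh by (auto simp: interval_blocks_def distrib_left)
    show "interval_blocks q ?T \<subseteq> rmap ?f (interval_blocks q ?S)"
    proof
      fix p assume "p \<in> interval_blocks q ?T"
      then obtain x y where p: "p = (x, y)" "x \<in> ?T" "y \<in> ?T" "(x - 1) div q = (y - 1) div q"
        by (auto simp: interval_blocks_def)
      then obtain u v where "u \<in> ?S" "v \<in> ?S" "x = ?f u" "y = ?f v" using img by blast
      with p(1,4) show "p \<in> rmap ?f (interval_blocks q ?S)"
        using sh[of u] sh[of v] by (auto simp: interval_blocks_def intro!: rev_image_eqI[of "(u, v)"])
    qed
  qed
  have iff: "(q * i + 1, q * (i + k)) \<in> join_blocks q ?T (rmap ?f E) \<longleftrightarrow> (1, q * k) \<in> join_blocks q ?S E"
    if "E \<in> ncr ?S" for E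
  proof -
    have "E \<union> interval_blocks q ?S \<subseteq> ?S \<times> ?S"
      using ncr_sub[OF that] by (auto simp: interval_blocks_def)
    moreover have "rmap ?f E \<union> interval_blocks q ?T = rmap ?f (E \<union> interval_blocks q ?S)"
      by (simp add: image_Un blk)
    moreover have "q * k \<ge> 1" using assms by simp
    ultimately show ?thesis
      using rmap_trancl[OF inj, of "E \<union> interval_blocks q ?S" 1 "q * k"] by (simp add: distrib_left)
  qed
  have "bij_betw (rmap ?f) {E \<in> ncr ?S. (1, q * k) \<in> join_blocks q ?S E}
     {E \<in> ncr ?T. (q * i + 1, q * (i + k)) \<in> join_blocks q ?T E}"
  proof -
    have b: "bij_betw (rmap ?f) (ncr ?S) (ncr ?T)" using bij_betw_rmap[OF mono] unfolding img .
    show ?thesis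
      unfolding bij_betw_def
    proof
      show "inj_on (rmap ?f) {E \<in> ncr ?S. (1, q * k) \<in> join_blocks q ?S E}"
        using b by (auto simp: bij_betw_def intro: inj_on_subset)
      show "rmap ?f ` {E \<in> ncr ?S. (1, q * k) \<in> join_blocks q ?S E} =
         {E \<in> ncr ?T. (q * i + 1, q * (i + k)) \<in> join_blocks q ?T E}" (is "?l = ?r")
      proof (intro equalityI subsetI)
        fix E assume "E \<in> ?l"
        then obtain E0 where "E = rmap ?f E0" "E0 \<in> ncr ?S" "(1, q * k) \<in> join_blocks q ?S E0" by blast
        then show "E \<in> ?r" using iff[of E0] bij_betwE[OF b] by blast
      next
        fix E assume E: "E \<in> ?r"
        then have "E \<in> rmap ?f ` ncr ?S" using bij_betw_imp_surj_on[OF b] by blast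
        then obtain E0 where "E = rmap ?f E0" "E0 \<in> ncr ?S" by blast
        then show "E \<in> ?l" using iff[of E0] E by blast
      qed
    qed
  qed
  then show ?thesis unfolding conn_count_def by (simp only: bij_betw_same_card)
qed

lemma card_ncr_shift: "card (ncr {a<..a + k}) = nc_count k"
proof -
  have "strict_mono_on {0<..k} (\<lambda>x. a + x)" by (auto intro!: strict_mono_onI)
  from bij_betw_same_card[OF bij_betw_rmap[OF this]] show ?thesis
    using image_add_greaterThanAtMost[of a 0 k] by (simp add: nc_count_def)
qed

text \<open>The relabelling jumps over the removed interval. It transports no condition on joins,
  since outside a hull every noncrossing relation is allowed.\<close>

lemma card_ncr_gap:
  assumes "a + d \<le> n"
  shows "card (ncr ({0<..n} - {a<..a + d})) = nc_count (n - d)"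
proof -
  let ?f = "\<lambda>x. if x \<le> a then x else x + d"
  have "strict_mono_on {0<..n - d} ?f" by (auto intro!: strict_mono_onI)
  moreover have "?f ` {0<..n - d} = {0<..n} - {a<..a + d}"
  proof (intro equalityI subsetI)
    fix x assume x: "x \<in> {0<..n} - {a<..a + d}"
    show "x \<in> ?f ` {0<..n - d}"
    proof (cases "x \<le> a")
      case True
      then show ?thesis using x assms by (intro image_eqI[of _ _ x]) auto
    next
      case False
      then show ?thesis using x assms by (intro image_eqI[of _ _ "x - d"]) auto
    qed
  qed (use assms in \<open>auto split: if_splits\<close>)
  ultimately show ?thesis using bij_betw_same_card[OF bij_betw_rmap] by (metis nc_count_def)
qed

text \<open>Some component of the join has minimum \<open>q i + 1\<close> and maximum \<open>q (i + k)\<close>. Nothing then leaves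
  the interval between them, so \<open>E\<close> splits into an inner and an outer part that can be chosen freely.\<close>

definition has_hull :: "nat \<Rightarrow> nat \<Rightarrow> nat \<Rightarrow> nat \<Rightarrow> nat rel \<Rightarrow> bool" where
  "has_hull q n i k E \<longleftrightarrow>
     (q * i + 1, q * (i + k)) \<in> join_blocks q {0<..q * n} E \<and>
     join_blocks q {0<..q * n} E `` {q * i + 1} \<subseteq> {q * i<..q * (i + k)}"

lemma ncr_restrict: "E \<in> ncr S \<Longrightarrow> I \<subseteq> S \<Longrightarrow> E \<inter> I \<times> I \<in> ncr I"
proof (rule ncrI)
  assume E: "E \<in> ncr S" and I: "I \<subseteq> S"
  show "E \<inter> I \<times> I \<subseteq> I \<times> I" by blast
  show "(x, x) \<in> E \<inter> I \<times> I" if "x \<in> I" for x using that I ncr_refl[OF E] by blast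
  show "(y, x) \<in> E \<inter> I \<times> I" if "(x, y) \<in> E \<inter> I \<times> I" for x y using that ncr_sym[OF E] by blast
  show "(x, z) \<in> E \<inter> I \<times> I" if "(x, y) \<in> E \<inter> I \<times> I" "(y, z) \<in> E \<inter> I \<times> I" for x y z
    using that ncr_trans[OF E] by blast
  show "((x < u) = (y < u)) = ((x < v) = (y < v))"
    if "(x, y) \<in> E \<inter> I \<times> I" "(u, v) \<in> E \<inter> I \<times> I" "(x, u) \<notin> E \<inter> I \<times> I" for x y u v
    by (rule nc_relD[OF ncr_nc[OF E]]) (use that in auto)
qed

lemma join_blocks_ncr: "E \<in> ncr S \<Longrightarrow> join_blocks q S E \<in> ncr S"
  using ncr_join_convex equiv_interval_blocks interval_blocks_convex by metis

lemma trancl_split: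
  assumes "G \<subseteq> I \<times> I \<union> O' \<times> O'" "I \<inter> O' = {}" "(x, y) \<in> G\<^sup>+" "x \<in> I"
  shows "y \<in> I \<and> (x, y) \<in> (G \<inter> I \<times> I)\<^sup>+"
  using assms(3)
proof (induction rule: trancl_induct)
  case (base y)
  then show ?case using assms by blast
next
  case (step y z)
  then have "(y, z) \<in> G \<inter> I \<times> I" using assms by blast
  then show ?case using step.IH by (blast intro: trancl_into_trancl)
qed

text \<open>Both ends of \<open>I\<close> are multiples of \<open>q\<close>, so no block is
  cut.\<close>

lemma interval_blocks_split:
  assumes "q \<ge> 1" "I = {q * i<..q * j}" "I \<subseteq> S" "S \<subseteq> {0<..}"
  shows "interval_blocks q S \<subseteq> I \<times> I \<union> (S - I) \<times> (S - I)"
    and "interval_blocks q S \<inter> I \<times> I = interval_blocks q I"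
proof -
  have "x \<in> I \<longleftrightarrow> i \<le> (x - 1) div q \<and> (x - 1) div q < j" if "x \<in> S" for x
  proof -
    have "0 < x" using that assms(4) by auto
    then show ?thesis using assms(1)
      by (simp add: assms(2) less_eq_div_iff_mult_less_eq div_less_iff_less_mult mult.commute) linarith
  qed
  then show "interval_blocks q S \<subseteq> I \<times> I \<union> (S - I) \<times> (S - I)"
    unfolding interval_blocks_def by auto
  show "interval_blocks q S \<inter> I \<times> I = interval_blocks q I"
    using assms(3) by (auto simp: interval_blocks_def)
qed

text \<open>The chord between the ends of \<open>I\<close> belongs to the join rather than to
  \<open>E\<close>, so it is the noncrossing property of the join that keeps an
  \<open>E\<close>-chord starting under it from escaping. Points in the component of the ends
  themselves are held inside by the second half of \<open>has_hull\<close>.\<close>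

lemma has_hull_separates:
  assumes E: "E \<in> ncr {0<..q * n}" and h: "has_hull q n i k E" and "q \<ge> 1" "k \<ge> 1" "i + k \<le> n"
    and I: "I = {q * i<..q * (i + k)}"
  shows "E \<subseteq> I \<times> I \<union> ({0<..q * n} - I) \<times> ({0<..q * n} - I)"
proof -
  let ?S = "{0<..q * n}" and ?a = "q * i + 1" and ?c = "q * (i + k)"
  let ?J = "join_blocks q ?S E"
  have J: "?J \<in> ncr ?S" using E by (rule join_blocks_ncr)
  have ac: "(?a, ?c) \<in> ?J" and sub: "?J `` {?a} \<subseteq> I" using h by (auto simp: has_hull_def I)
  have aa: "(?a, ?a) \<in> ?J" using ncr_sym[OF J ac] ncr_trans[OF J ac] by blast
  have *: "y \<in> I" if xy: "(x, y) \<in> E" and x: "x \<in> I" for x y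
  proof (cases "(?a, x) \<in> ?J")
    case True
    then have "(?a, y) \<in> ?J" using xy by (meson UnI1 trancl_into_trancl)
    then show ?thesis using sub by blast
  next
    case False
    have "(x, y) \<in> ?J" using xy by auto
    then have "((?a < x) = (?c < x)) = ((?a < y) = (?c < y))"
      using nc_relD[OF ncr_nc[OF J] ac _ False] by blast
    moreover have "?a < x" "x < ?c"
    proof -
      have "x \<noteq> ?a" "x \<noteq> ?c" using False ac aa by metis+
      moreover have "q * i < x" "x \<le> ?c" using x by (auto simp: I)
      ultimately show "?a < x" "x < ?c" by linarith+
    qed
    ultimately show ?thesis by (auto simp: I)
  qed
  show ?thesis
  proof
    fix p assume p: "p \<in> E"
    obtain x y where xy: "p = (x, y)" by (cases p)
    have "(y, x) \<in> E" "x \<in> ?S" "y \<in> ?S" using p xy ncr_sym[OF E] ncr_sub[OF E] by auto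
    then show "p \<in> I \<times> I \<union> (?S - I) \<times> (?S - I)" using *[of x y] *[of y x] p xy by blast
  qed
qed

text \<open>Since \<open>I\<close> is an interval, a point outside it lies on the same side of all
  its points; inner and outer chords therefore never separate each other.\<close>

lemma ncr_glue:
  assumes E1: "E1 \<in> ncr I" and E2: "E2 \<in> ncr (S - I)" and I: "I = {a<..b}" "I \<subseteq> S"
  shows "E1 \<union> E2 \<in> ncr S"
proof (rule ncrI)
  note s = ncr_sub[OF E1] ncr_sub[OF E2]
  show "E1 \<union> E2 \<subseteq> S \<times> S" using s I(2) by blast
  show "(x, x) \<in> E1 \<union> E2" if "x \<in> S" for x using that ncr_refl[OF E1] ncr_refl[OF E2] by blast
  show "(y, x) \<in> E1 \<union> E2" if "(x, y) \<in> E1 \<union> E2" for x y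
    using that ncr_sym[OF E1] ncr_sym[OF E2] by blast
  show "(x, z) \<in> E1 \<union> E2" if "(x, y) \<in> E1 \<union> E2" "(y, z) \<in> E1 \<union> E2" for x y z
    using that ncr_trans[OF E1] ncr_trans[OF E2] s by blast
  show "((x < u) = (y < u)) = ((x < v) = (y < v))"
    if xy: "(x, y) \<in> E1 \<union> E2" and uv: "(u, v) \<in> E1 \<union> E2" and n: "(x, u) \<notin> E1 \<union> E2" for x y u v
  proof -
    consider "(x, y) \<in> E1" "(u, v) \<in> E1" | "(x, y) \<in> E1" "(u, v) \<in> E2" |
      "(x, y) \<in> E2" "(u, v) \<in> E1" | "(x, y) \<in> E2" "(u, v) \<in> E2" using xy uv by blast
    then show ?thesis
    proof cases
      case 1 then show ?thesis using n nc_relD[OF ncr_nc[OF E1]] by blast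
    next
      case 2
      then have "x \<in> I" "y \<in> I" "u \<notin> I" "v \<notin> I" using s by auto
      then show ?thesis by (auto simp: I)
    next
      case 3
      then have "x \<notin> I" "y \<notin> I" "u \<in> I" "v \<in> I" using s by auto
      then show ?thesis by (auto simp: I)
    next
      case 4 then show ?thesis using n nc_relD[OF ncr_nc[OF E2]] by blast
    qed
  qed
qed

lemma card_has_hull:
  assumes q: "q \<ge> 1" and k: "k \<ge> 1" and n: "i + k \<le> n"
  shows "card {E \<in> ncr {0<..q * n}. has_hull q n i k E} = conn_count q k * nc_count (q * (n - k))"
proof -
  define S where "S = {0<..q * n}"
  define I where "I = {q * i<..q * (i + k)}"
  define Q where "Q = S - I"
  let ?a = "q * i + 1" and ?c = "q * (i + k)"
  let ?X = "{E \<in> ncr S. has_hull q n i k E}"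
  let ?Y = "{E \<in> ncr I. (?a, ?c) \<in> join_blocks q I E}"
  have "q * (i + k) \<le> q * n" using n by (rule mult_le_mono2)
  then have "x \<le> q * n" if "x \<le> q * (i + k)" for x using that by (rule order_trans[rotated])
  then have IS: "I \<subseteq> S" by (auto simp: I_def S_def)
  have "q * k \<ge> 1" using q k by simp
  then have aI: "?a \<in> I" by (auto simp: I_def distrib_left)
  have "S \<subseteq> {0<..}" by (auto simp: S_def)
  note blk = interval_blocks_split[OF q I_def IS this, folded Q_def]
  have IQ: "I \<inter> Q = {}" by (auto simp: Q_def)
  \<comment> \<open>Neither \<open>E\<close> nor the blocks link \<open>I\<close> to its complement,
    so paths from \<open>?a\<close> stay in \<open>I\<close>. The containment half of
    \<open>has_hull\<close> is then automatic, and the other half depends on the inner part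
    alone.\<close>
  have hull: "has_hull q n i k E \<longleftrightarrow> (?a, ?c) \<in> join_blocks q I (E \<inter> I \<times> I)"
    if "E \<subseteq> I \<times> I \<union> Q \<times> Q" for E
  proof -
    let ?G = "E \<union> interval_blocks q S"
    have G: "?G \<subseteq> I \<times> I \<union> Q \<times> Q" using that blk(1) by blast
    have eq: "?G \<inter> I \<times> I = E \<inter> I \<times> I \<union> interval_blocks q I" using blk(2) by blast
    have sp: "y \<in> I \<and> (?a, y) \<in> join_blocks q I (E \<inter> I \<times> I)" if "(?a, y) \<in> ?G\<^sup>+" for y
      using trancl_split[OF G IQ that aI] unfolding eq .
    have "join_blocks q I (E \<inter> I \<times> I) \<subseteq> ?G\<^sup>+"
      unfolding eq[symmetric] by (rule trancl_mono_subset) blast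
    then show ?thesis
      unfolding has_hull_def S_def[symmetric] I_def[symmetric] using sp by blast
  qed
  have sep: "E \<subseteq> I \<times> I \<union> Q \<times> Q" if "E \<in> ?X" for E
    using has_hull_separates[OF _ _ q k n I_def] that by (auto simp: S_def Q_def)
  have "bij_betw (\<lambda>E. (E \<inter> I \<times> I, E \<inter> Q \<times> Q)) ?X (?Y \<times> ncr Q)"
  proof (rule bij_betw_byWitness[where f' = "\<lambda>(E1, E2). E1 \<union> E2"])
    show "\<forall>E\<in>?X. (\<lambda>(E1, E2). E1 \<union> E2) (E \<inter> I \<times> I, E \<inter> Q \<times> Q) = E"
      using sep by auto
    show "\<forall>p\<in>?Y \<times> ncr Q. (\<lambda>E. (E \<inter> I \<times> I, E \<inter> Q \<times> Q)) ((\<lambda>(E1, E2). E1 \<union> E2) p) = p"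
      using ncr_sub[of _ I] ncr_sub[of _ Q] IQ by fastforce
    show "(\<lambda>E. (E \<inter> I \<times> I, E \<inter> Q \<times> Q)) ` ?X \<subseteq> ?Y \<times> ncr Q"
    proof
      fix p assume "p \<in> (\<lambda>E. (E \<inter> I \<times> I, E \<inter> Q \<times> Q)) ` ?X"
      then obtain E where E: "E \<in> ?X" "p = (E \<inter> I \<times> I, E \<inter> Q \<times> Q)" by blast
      then have "E \<inter> I \<times> I \<in> ncr I" "E \<inter> Q \<times> Q \<in> ncr Q"
        using IS by (auto intro!: ncr_restrict simp: Q_def)
      then show "p \<in> ?Y \<times> ncr Q" using E hull[OF sep[OF E(1)]] by simp
    qed
    show "(\<lambda>(E1, E2). E1 \<union> E2) ` (?Y \<times> ncr Q) \<subseteq> ?X"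
    proof
      fix E assume "E \<in> (\<lambda>(E1, E2). E1 \<union> E2) ` (?Y \<times> ncr Q)"
      then obtain E1 E2 where E: "E = E1 \<union> E2" "E1 \<in> ?Y" "E2 \<in> ncr Q" by auto
      have s: "E1 \<subseteq> I \<times> I" "E2 \<subseteq> Q \<times> Q" using E ncr_sub by auto
      then have "E \<inter> I \<times> I = E1" using IQ E(1) by blast
      moreover have "E \<subseteq> I \<times> I \<union> Q \<times> Q" using s E(1) by blast
      moreover have "E \<in> ncr S" using E ncr_glue[OF _ _ I_def IS] by (simp add: Q_def)
      ultimately show "E \<in> ?X" using hull[of E] E(2) by simp
    qed
  qed
  then have "card ?X = card ?Y * card (ncr Q)"
    by (simp add: bij_betw_same_card card_cartesian_product)
  moreover have "card ?Y = conn_count q k" unfolding I_def by (rule card_ncr_shift_conn[OF q k])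
  moreover have "card (ncr Q) = nc_count (q * (n - k))"
  proof -
    have "Q = {0<..q * n} - {q * i<..q * i + q * k}" by (simp add: Q_def S_def I_def distrib_left)
    then show ?thesis using card_ncr_gap[of "q * i" "q * k" "q * n"] \<open>q * (i + k) \<le> q * n\<close>
      by (simp add: distrib_left right_diff_distrib')
  qed
  ultimately show ?thesis by (simp add: S_def)
qed

text \<open>A component determines its hull through its extreme points, and a hull determines its
  component through its left end. The length \<open>k\<close> precedes the position \<open>i\<close>
  in the index because the count of relations with a given hull depends on \<open>k\<close>
  only.\<close>

lemma bij_betw_hulls:
  assumes q: "q \<ge> 1" and E: "E \<in> ncr {0<..q * n}"
  shows "bij_betw (\<lambda>(k, i). join_blocks q {0<..q * n} E `` {q * i + 1})
    {(k, i) \<in> Sigma {1..n} (\<lambda>k. {..n - k}). has_hull q n i k E}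
    ({0<..q * n} // join_blocks q {0<..q * n} E)"
proof -
  define S where "S = {0<..q * n}"
  define J where "J = join_blocks q S E"
  have J: "J \<in> ncr S" unfolding J_def using E by (auto simp: S_def intro: join_blocks_ncr)
  have blk: "(x, y) \<in> J" if "x \<in> S" "y \<in> S" "(x - 1) div q = (y - 1) div q" for x y
    using that by (auto simp: J_def interval_blocks_def)
  have hh: "has_hull q n i k E \<longleftrightarrow> (q * i + 1, q * (i + k)) \<in> J \<and> J `` {q * i + 1} \<subseteq> {q * i<..q * (i + k)}" for i k
    by (simp add: has_hull_def J_def S_def)
  show ?thesis
    unfolding S_def[symmetric] J_def[symmetric] bij_betw_def
  proof
    show "inj_on (\<lambda>(k, i). J `` {q * i + 1}) {(k, i) \<in> Sigma {1..n} (\<lambda>k. {..n - k}). has_hull q n i k E}"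
    proof (rule inj_onI, clarsimp)
      fix k i k' i'
      assume h: "has_hull q n i k E" "has_hull q n i' k' E" and eq: "J `` {Suc (q * i)} = J `` {Suc (q * i')}"
      have a: "q * i + 1 \<in> J `` {q * i + 1}" if "has_hull q n i k E" for i k
        using that ncr_refl[OF J] ncr_sub[OF J] unfolding hh by blast
      have "q * i + 1 \<in> {q * i'<..q * (i' + k')}" "q * i' + 1 \<in> {q * i<..q * (i + k)}"
        using a[OF h(1)] a[OF h(2)] h eq unfolding hh by auto
      then have i: "i = i'" using q by (simp add: less_Suc_eq_le)
      have "q * (i + k) \<in> {q * i'<..q * (i' + k')}" "q * (i' + k') \<in> {q * i<..q * (i + k)}"
        using h eq unfolding hh by auto
      then have "i + k = i' + k'" using q by simp
      then show "k = k' \<and> i = i'" using i by simp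
    qed
    show "(\<lambda>(k, i). J `` {q * i + 1}) ` {(k, i) \<in> Sigma {1..n} (\<lambda>k. {..n - k}). has_hull q n i k E} = S // J"
    proof (intro equalityI subsetI)
      fix C assume "C \<in> (\<lambda>(k, i). J `` {q * i + 1}) ` {(k, i) \<in> Sigma {1..n} (\<lambda>k. {..n - k}). has_hull q n i k E}"
      then obtain i k where "C = J `` {q * i + 1}" "has_hull q n i k E" by auto
      then show "C \<in> S // J" using ncr_sub[OF J] unfolding hh by (auto intro: quotientI)
    next
      fix C assume "C \<in> S // J"
      then obtain x where x: "x \<in> S" "C = J `` {x}" by (auto elim: quotientE)
      have xC: "x \<in> C" using x ncr_refl[OF J] by blast
      have CS: "C \<subseteq> S" using x ncr_sub[OF J] by auto
      have fin: "finite C" using CS by (auto simp: S_def intro: finite_subset)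
      have closed: "v \<in> C" if "u \<in> C" "v \<in> S" "(u - 1) div q = (v - 1) div q" for u v
        using that blk[of u v] CS x ncr_trans[OF J] by blast
      have CJ: "C = J `` {u}" if "u \<in> C" for u
        using that x ncr_trans[OF J] ncr_sym[OF J] by blast
      \<comment> \<open>A component is a union of whole blocks, so moving from \<open>Min C\<close>
        down and from \<open>Max C\<close> up to the ends of their blocks does not leave
        \<open>C\<close>.\<close>
      define i where "i = (Min C - 1) div q"
      define j where "j = (Max C - 1) div q + 1"
      have MinC: "Min C \<in> C" and MaxC: "Max C \<in> C" using fin xC by (auto intro: Min_in Max_in)
      have pos: "0 < Min C" "0 < Max C" "Max C \<le> q * n" "Min C \<le> Max C"
        using MinC MaxC CS fin by (auto simp: S_def)
      have "q * i \<le> Min C - 1" unfolding i_def by (rule times_div_less_eq_dividend)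
      then have a_le: "q * i + 1 \<le> Min C" using pos by linarith
      have le_c: "Max C \<le> q * j" using q pos(2) dividend_less_times_div[of q "Max C - 1"]
        unfolding j_def by (simp add: distrib_left)
      have "(Max C - 1) div q < n"
        using q pos(2,3) by (simp add: div_less_iff_less_mult mult.commute) 
      then have jn: "j \<le> n" by (simp add: j_def)
      have ij: "i < j" unfolding i_def j_def using pos by (simp add: div_le_mono less_Suc_eq_le)
      have "q * j \<le> q * n" using jn by simp
      moreover have "1 \<le> q * j" using q ij by simp
      ultimately have cS: "q * j \<in> S" by (simp add: S_def)
      have aS: "q * i + 1 \<in> S" using a_le MinC CS pos by (auto simp: S_def)
      have aC: "q * i + 1 \<in> C" using closed[OF MinC aS] q by (simp add: i_def)
      have "(q * j - 1) div q = (Max C - 1) div q"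
      proof -
        have "q * j - 1 = (q - 1) + q * ((Max C - 1) div q)" using q by (simp add: j_def distrib_left)
        moreover have "((q - 1) + q * z) div q = z" for z
        proof -
          have "((q - 1) + q * z) div q = z + (q - 1) div q" using q by (intro div_mult_self2) simp
          also have "(q - 1) div q = 0" using q by simp
          finally show ?thesis by simp
        qed
        ultimately show ?thesis by presburger
      qed
      then have cC: "q * j \<in> C" using closed[OF MaxC cS] by simp
      have "C \<subseteq> {q * i<..q * j}"
      proof
        fix y assume "y \<in> C"
        then have "Min C \<le> y" "y \<le> Max C" using fin by auto
        then show "y \<in> {q * i<..q * j}" using a_le le_c by auto
      qed
      then have "has_hull q n i (j - i) E"
        unfolding hh using aC cC CJ[OF aC] ij by auto
      moreover have "(j - i, i) \<in> Sigma {1..n} (\<lambda>k. {..n - k})" using ij jn by auto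
      ultimately show "C \<in> (\<lambda>(k, i). J `` {q * i + 1}) ` {(k, i) \<in> Sigma {1..n} (\<lambda>k. {..n - k}). has_hull q n i k E}"
        using CJ[OF aC] by (auto intro!: rev_image_eqI[of "(j - i, i)"])
    qed
  qed
qed

lemma sum_card_swap:
  assumes "finite A" "finite B"
  shows "(\<Sum>x\<in>A. card {y \<in> B. P x y}) = (\<Sum>y\<in>B. card {x \<in> A. P x y})"
proof -
  have "(\<Sum>x\<in>A. card {y \<in> B. P x y}) = (\<Sum>x\<in>A. \<Sum>y | y \<in> B \<and> P x y. 1)" by simp
  also have "\<dots> = (\<Sum>y\<in>B. \<Sum>x | x \<in> A \<and> P x y. 1)" using assms by (rule sum.swap_restrict)
  finally show ?thesis by simp
qed

text \<open>Components are counted by their hulls and the two sums exchanged; the summand ignores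
  the position \<open>i\<close>, whose \<open>n - k + 1\<close> values become the weight.\<close>

lemma sum_card_join_blocks:
  assumes q: "q \<ge> 1"
  shows "(\<Sum>E\<in>ncr {0<..q * n}. card ({0<..q * n} // join_blocks q {0<..q * n} E)) =
    (\<Sum>k=1..n. (n - k + 1) * (conn_count q k * nc_count (q * (n - k))))"
proof -
  let ?S = "{0<..q * n}" and ?P = "Sigma {1..n} (\<lambda>k. {..n - k})"
  have "(\<Sum>E\<in>ncr ?S. card (?S // join_blocks q ?S E)) =
      (\<Sum>E\<in>ncr ?S. card {p \<in> ?P. has_hull q n (snd p) (fst p) E})"
  proof (rule sum.cong[OF refl])
    fix E assume "E \<in> ncr ?S"
    from bij_betw_same_card[OF bij_betw_hulls[OF q this]]
    have "card {(k, i) \<in> ?P. has_hull q n i k E} = card (?S // join_blocks q ?S E)" .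
    moreover have "{(k, i) \<in> ?P. has_hull q n i k E} = {p \<in> ?P. has_hull q n (snd p) (fst p) E}" by auto
    ultimately
    show "card (?S // join_blocks q ?S E) = card {p \<in> ?P. has_hull q n (snd p) (fst p) E}"
      by argo
  qed
  also have "\<dots> = (\<Sum>p\<in>?P. card {E \<in> ncr ?S. has_hull q n (snd p) (fst p) E})"
    by (rule sum_card_swap) (auto simp: finite_ncr)
  also have "\<dots> = (\<Sum>p\<in>?P. conn_count q (fst p) * nc_count (q * (n - fst p)))"
    by (rule sum.cong[OF refl], rule card_has_hull[OF q]) auto
  also have "\<dots> = (\<Sum>k=1..n. \<Sum>i\<le>n - k. conn_count q k * nc_count (q * (n - k)))"
    by (subst sum.Sigma) (auto simp: case_prod_unfold)
  finally show ?thesis by simp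
qed

text \<open>This is \<open>F = 1 + A F\<close>: exactly one component contains the point 1, and its
  hull has \<open>i = 0\<close>.\<close>

lemma nc_count_rec:
  assumes q: "q \<ge> 1" and n: "n \<ge> 1"
  shows "nc_count (q * n) = (\<Sum>k=1..n. conn_count q k * nc_count (q * (n - k)))"
proof -
  let ?S = "{0<..q * n}"
  have one: "card {k \<in> {1..n}. has_hull q n 0 k E} = 1" if E: "E \<in> ncr ?S" for E
  proof -
    let ?J = "join_blocks q ?S E"
    have J: "?J \<in> ncr ?S" using E by (rule join_blocks_ncr)
    note b = bij_betw_hulls[OF q E]
    have 1: "1 \<in> ?S" using q n by simp
    then have "?J `` {1} \<in> ?S // ?J" by (rule quotientI)
    then have "?J `` {1} \<in> (\<lambda>(k, i). ?J `` {q * i + 1}) `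
        {(k, i) \<in> Sigma {1..n} (\<lambda>k. {..n - k}). has_hull q n i k E}"
      unfolding bij_betw_imp_surj_on[OF b] .
    then obtain k i where ki: "k \<in> {1..n}" "has_hull q n i k E" "?J `` {1} = ?J `` {q * i + 1}"
      by (elim imageE) auto
    have "1 \<in> ?J `` {q * i + 1}" using ncr_refl[OF J 1] ki(3) by blast
    then have "1 \<in> {q * i<..q * (i + k)}" using ki(2) unfolding has_hull_def by blast
    then have i: "i = 0" using q by auto
    have "k' = k" if "k' \<in> {1..n}" "has_hull q n 0 k' E" for k'
    proof -
      have "(k', 0) = (k, 0 :: nat)"
        by (rule inj_onD[OF bij_betw_imp_inj_on[OF b]]) (use that ki i in auto)
      then show ?thesis by simp
    qed
    moreover have "has_hull q n 0 k E" using ki(2) i by simp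
    ultimately have "{k \<in> {1..n}. has_hull q n 0 k E} = {k}" using ki(1) by blast
    then show ?thesis by simp
  qed
  have "nc_count (q * n) = (\<Sum>E\<in>ncr ?S. card {k \<in> {1..n}. has_hull q n 0 k E})"
    using one by (simp add: nc_count_def)
  also have "\<dots> = (\<Sum>k=1..n. card {E \<in> ncr ?S. has_hull q n 0 k E})"
    by (rule sum_card_swap) (auto simp: finite_ncr)
  also have "\<dots> = (\<Sum>k=1..n. conn_count q k * nc_count (q * (n - k)))"
    by (rule sum.cong[OF refl], use card_has_hull[OF q, of _ 0] in simp)
  finally show ?thesis .
qed

lemma nc_count_0 [simp]: "nc_count 0 = 1"
proof -
  have "ncr {0<..0} = {{}}" by (auto dest: ncr_sub intro!: ncrI)
  then show ?thesis by (simp add: nc_count_def)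
qed

section \<open>Block length one\<close>

lemma join_blocks_1:
  assumes "E \<in> ncr {0<..n}"
  shows "join_blocks 1 {0<..n} E = E"
proof -
  have "E \<union> interval_blocks 1 {0<..n} = E"
    using ncr_refl[OF assms] by (auto simp: interval_blocks_def dest: diff_diff_cancel Suc_pred eq_diff_iff[THEN iffD1, rotated 2])
  then show ?thesis using ncr_equiv[OF assms] by (simp add: equiv_def)
qed

text \<open>For blocks of length one the condition reads \<open>(1, k) \<in> E\<close>, so the point
  1 can be deleted without loss. Conversely it is attached to the class of \<open>k\<close>; the
  chord from 1 to \<open>k\<close> spans the whole set and hence separates nothing.\<close>

lemma conn_count_1:
  assumes "k \<ge> 1"
  shows "conn_count 1 k = nc_count (k - 1)"
proof -
  let ?S = "{0<..k}" and ?T = "{1<..k}"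
  have cc: "conn_count 1 k = card {E \<in> ncr ?S. (1, k) \<in> E}"
    unfolding conn_count_def by (rule arg_cong[of _ _ card]) (auto simp: join_blocks_1[unfolded One_nat_def])
  show ?thesis
  proof (cases "k = 1")
    \<comment> \<open>Here \<open>?T\<close> is empty and contains no \<open>k\<close> to which 1
      could be attached, so this case is counted directly.\<close>
    case True
    have S: "{0<..Suc 0} = {Suc 0}" by auto
    have "{E \<in> ncr {Suc 0}. (Suc 0, Suc 0) \<in> E} = {{(Suc 0, Suc 0)}}"
      by (auto dest: ncr_sub intro!: ncrI)
    then show ?thesis using True cc by (simp add: S)
  next
    case False
    then have k: "1 < k" using assms by simp
    let ?F = "\<lambda>E. merge (insert (1, 1) E) 1 k"
    have ins: "insert (1, 1) E \<in> ncr ?S" if E: "E \<in> ncr ?T" for E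
    proof -
      have "E \<in> ncr ({0<..k} - {0<..1})"
      proof -
        have "{0<..k} - {0<..1} = ?T" by auto
        then show ?thesis using E by simp
      qed
      moreover have "{(1, 1)} \<in> ncr {0<..1}" by (rule ncrI) auto
      moreover have "{0<..1} \<subseteq> ?S" using k by auto
      ultimately have "{(1, 1)} \<union> E \<in> ncr ?S" using ncr_glue by blast
      then show ?thesis by simp
    qed
    have F: "?F E = insert (1, 1) E \<union> {1} \<times> E `` {k} \<union> E `` {k} \<times> {1}" if E: "E \<in> ncr ?T" for E
    proof -
      have "insert (1, 1) E `` {1} = {1}" "insert (1, 1) E `` {k} = E `` {k}"
        using ncr_sub[OF E] k by auto
      then show ?thesis using merge_eq[OF ncr_equiv[OF ins[OF E]], of 1 k] k by simp
    qed
    have "bij_betw (\<lambda>E. E \<inter> ?T \<times> ?T) {E \<in> ncr ?S. (1, k) \<in> E} (ncr ?T)"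
    proof (rule bij_betw_byWitness[where f' = ?F])
      show "\<forall>E\<in>{E \<in> ncr ?S. (1, k) \<in> E}. ?F (E \<inter> ?T \<times> ?T) = E"
      proof safe
        fix E x y assume E: "E \<in> ncr ?S" and 1: "(1, k) \<in> E"
        have r: "E \<inter> ?T \<times> ?T \<in> ncr ?T" using E by (rule ncr_restrict) auto
        note t = ncr_trans[OF E] and s = ncr_sym[OF E]
        have 11: "(1, 1) \<in> E" and kk: "(k, k) \<in> E" using 1 s t by blast+
        have k1: "(k, 1) \<in> E" using 1 s by blast
        show "(x, y) \<in> E" if "(x, y) \<in> ?F (E \<inter> ?T \<times> ?T)"
          using that unfolding F[OF r] using 1 11 k1 t s by blast
        show "(x, y) \<in> ?F (E \<inter> ?T \<times> ?T)" if xy: "(x, y) \<in> E"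
        proof -
          have m: "x = 1 \<or> x \<in> ?T" "y = 1 \<or> y \<in> ?T" using xy ncr_sub[OF E] by auto
          have kT: "k \<in> ?T" using k by simp
          have a: "(k, y) \<in> E" if "x = 1" using that xy k1 t by blast
          have b: "(k, x) \<in> E" if "y = 1" using that xy k1 t s by blast
          show ?thesis unfolding F[OF r] using m kT a b xy 11 by blast
        qed
      qed
      show "\<forall>E\<in>ncr ?T. ?F E \<inter> ?T \<times> ?T = E"
      proof
        fix E assume E: "E \<in> ncr ?T"
        show "?F E \<inter> ?T \<times> ?T = E" unfolding F[OF E] using ncr_sub[OF E] by auto
      qed
      show "(\<lambda>E. E \<inter> ?T \<times> ?T) ` {E \<in> ncr ?S. (1, k) \<in> E} \<subseteq> ncr ?T"
        by (auto intro!: ncr_restrict)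
      show "?F ` ncr ?T \<subseteq> {E \<in> ncr ?S. (1, k) \<in> E}"
      proof safe
        fix E assume E: "E \<in> ncr ?T"
        show "(1, k) \<in> ?F E" by auto
        let ?M = "{(1, k), (k, 1)} :: nat rel"
        have *: "((x < u) = (y < u)) = ((x < v) = (y < v))"
          if "(x, y) \<in> ?M" "(u, v) \<in> insert (1, 1) E \<union> ?M" "(x, u) \<notin> ?F E" for x y u v
        proof -
          have uv: "(u, v) \<in> ?F E" using that(2) by blast
          have "u \<in> ?S" "v \<in> ?S" using that(2) ncr_sub[OF E] k by auto
          moreover have "(x, 1) \<in> ?F E" "(x, k) \<in> ?F E"
            using that(1) by (auto intro: r_into_trancl' trancl_trans)
          then have "u \<noteq> 1" "u \<noteq> k" using that(3) by auto
          moreover have "(v, u) \<in> ?F E"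
            using that(2) ncr_sym[OF ins[OF E]] by blast
          then have "(x, v) \<notin> ?F E" using that(3) by (meson trancl_trans)
          then have "v \<noteq> 1" "v \<noteq> k" using \<open>(x, 1) \<in> ?F E\<close> \<open>(x, k) \<in> ?F E\<close> by auto
          ultimately show ?thesis using that(1) by auto
        qed
        show "?F E \<in> ncr ?S"
          by (rule ncr_trancl[OF ins[OF E]]) (use k * in \<open>auto simp: sym_def\<close>)
      qed
    qed
    then have "conn_count 1 k = card (ncr ?T)" using cc by (simp add: bij_betw_same_card)
    also have "\<dots> = nc_count (k - 1)" using card_ncr_shift[of 1 "k - 1"] k by simp
    finally show ?thesis .
  qed
qed

section \<open>Catalan generating functions\<close>

unbundle no vec_syntax
unbundle fps_syntax

lemma Cat_0 [simp]: "Cat 0 = 1"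
  by (simp add: Cat_def)

lemma Cat_Suc: "(real n + 2) * Cat (Suc n) = (4 * real n + 2) * Cat n"
proof -
  have "fact (2 * Suc n) = (2 * real n + 2) * (2 * real n + 1) * fact (2 * n)"
    by (simp add: algebra_simps)
  then have "Cat (Suc n) * (fact (Suc n) * fact (Suc n + 1)) = (2 * real n + 2) * (2 * real n + 1) * fact (2 * n)"
    by (simp add: Cat_def)
  moreover have "Cat n * (fact n * fact (n + 1)) = fact (2 * n)"
    by (simp add: Cat_def)
  ultimately have "Cat (Suc n) * ((1 + real n) * fact n * ((2 + real n) * fact (n + 1)))
      = (2 * real n + 2) * (2 * real n + 1) * (Cat n * (fact n * fact (n + 1)))"
    by (simp add: algebra_simps)
  then have "(fact n * fact (n + 1) * (1 + real n)) * ((real n + 2) * Cat (Suc n))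
      = (fact n * fact (n + 1) * (1 + real n)) * ((4 * real n + 2) * Cat n)"
    by (simp only: algebra_simps)
  then show ?thesis by (subst (asm) mult_left_cancel) auto
qed

lemma Cat_pos: "0 < Cat n"
  by (simp add: Cat_def)

text \<open>\<open>sqrt (1 - 4x)\<close>, expressed through the generating function of a sequence \<open>c\<close> with the Catalan recurrence\<close>

definition disc_root :: "(nat \<Rightarrow> real) \<Rightarrow> real fps" where
  "disc_root c = 1 - 2 * fps_X * Abs_fps c"

lemma disc_root_nth: "disc_root c $ n = (if n = 0 then 1 else - 2 * c (n - 1))"
proof -
  have "disc_root c = 1 - fps_X * (fps_const 2 * Abs_fps c)"
    by (simp add: disc_root_def numeral_fps_const mult_ac)
  then show ?thesis by simp
qed

text \<open>The recurrence is \<open>C = 1 + X C^2\<close>; completing the square gives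
  \<open>(1 - 2XC)^2 = 1 - 4X (C - X C^2)\<close>.\<close>

lemma disc_root_square:
  assumes "c 0 = 1" "\<And>n. c (Suc n) = (\<Sum>i\<le>n. c i * c (n - i))"
  shows "disc_root c ^ 2 = 1 - 4 * fps_X"
proof -
  let ?C = "Abs_fps c"
  have C: "?C = 1 + fps_X * ?C ^ 2"
  proof (rule fps_ext)
    fix n
    have "(?C ^ 2) $ k = c (Suc k)" for k
      by (simp add: power2_eq_square fps_mult_nth atLeast0AtMost assms(2))
    then show "?C $ n = (1 + fps_X * ?C ^ 2) $ n"
      using assms(1) by (cases n) simp_all
  qed
  have "disc_root c ^ 2 = 1 - 4 * fps_X * (?C - fps_X * ?C ^ 2)"
    by (simp add: disc_root_def power2_eq_square algebra_simps)
  also have "?C - fps_X * ?C ^ 2 = 1" by (subst (1) C) simp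
  finally show ?thesis by simp
qed

text \<open>Differentiating the square root gives the linear equation
  \<open>(1 - 4x) y' = - 2 y\<close>, whose coefficients form the two-term recurrence of
  \<open>Cat_Suc\<close>.\<close>

lemma Cat_unique:
  assumes c: "c 0 = 1" "\<And>n. c (Suc n) = (\<Sum>i\<le>n. c i * c (n - i))"
  shows "c n = Cat n"
proof (induction n)
  case 0
  then show ?case using c by simp
next
  case (Suc n)
  let ?y = "disc_root c"
  have "fps_deriv (?y ^ 2) = - 4" by (simp add: disc_root_square[OF c])
  then have "2 * (?y * fps_deriv ?y) = 2 * (- 2)" by (simp add: power2_eq_square algebra_simps)
  then have "?y * fps_deriv ?y = - 2" by (simp only: mult_cancel_left) simp
  then have "?y ^ 2 * fps_deriv ?y = - 2 * ?y"
    by (simp add: power2_eq_square mult.assoc mult.left_commute)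
  then have "fps_deriv ?y - fps_X * (fps_const 4 * fps_deriv ?y) = fps_const (- 2) * ?y"
    by (simp add: disc_root_square[OF c] algebra_simps numeral_fps_const)
  then have "(fps_deriv ?y - fps_X * (fps_const 4 * fps_deriv ?y)) $ Suc n = (fps_const (- 2) * ?y) $ Suc n"
    by (simp only:)
  then have "(real n + 2) * c (Suc n) = (4 * real n + 2) * c n"
    by (simp add: disc_root_nth algebra_simps)
  also have "\<dots> = (real n + 2) * Cat (Suc n)" by (simp add: Suc Cat_Suc)
  finally show ?case by simp
qed

text \<open>\<open>(1 - 16x\<^sup>2)\<close> to the power \<open>-1/2\<close>\<close>

definition central_series :: "real fps" where
  "central_series = Abs_fps (\<lambda>n. if even n then 2 ^ n * real (n choose (n div 2)) else 0)"

lemma central_binomial_Suc: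
  "real (Suc n) * real (2 * Suc n choose Suc n) = 2 * (2 * real n + 1) * real (2 * n choose n)"
proof -
  have a: "real (2 * n choose n) = fact (2 * n) / (fact n * fact n)" for n
    by (simp add: binomial_fact mult_2)
  have "fact (2 * Suc n) = (2 * real n + 2) * (2 * real n + 1) * fact (2 * n)"
    by (simp add: algebra_simps)
  then show ?thesis unfolding a by (simp add: divide_simps) (simp add: algebra_simps)
qed

text \<open>The recurrence of the central binomial coefficients says
  \<open>(1 - 16x^2) r' = 16 x r\<close>. Together with \<open>h h' = - 16 x\<close> it gives
  \<open>(r h)' = 0\<close>; the constant term of \<open>h\<close> selects the root and fixes the
  product.\<close>

lemma central_series_mult:
  assumes h: "h ^ 2 = 1 - 16 * fps_X ^ 2" and h0: "h $ 0 = 1"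
  shows "central_series * h = 1"
proof -
  let ?r = central_series
  have "fps_deriv ?r - fps_X ^ 2 * (fps_const 16 * fps_deriv ?r) = fps_X * (fps_const 16 * ?r)"
  proof (rule fps_ext)
    fix n
    \<comment> \<open>Even coefficients vanish on both sides; at \<open>n = 1\<close> the term with
      \<open>fps_X ^ 2\<close> does not contribute yet.\<close>
    consider "even n" | "n = 1" | k where "n = 2 * Suc k + 1"
    proof (cases "even n")
      case False
      then obtain k where "n = 2 * k + 1" by (elim oddE)
      then show thesis using that by (cases k) auto
    qed (use that in blast)
    then show "(fps_deriv ?r - fps_X ^ 2 * (fps_const 16 * fps_deriv ?r)) $ n = (fps_X * (fps_const 16 * ?r)) $ n"
    proof cases
      case 1
      then show ?thesis by (auto simp: central_series_def fps_X_power_mult_nth)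
    next
      case 2
      then show ?thesis by (simp add: central_series_def fps_X_power_mult_nth)
    next
      case (3 k)
      define B where "B j = real (2 * j choose j)" for j
      have r: "?r $ (2 * j) = 4 ^ j * B j" for j
        by (simp add: central_series_def power_mult B_def)
      have "real (n + 1) * ?r $ (2 * Suc (Suc k)) - 16 * (real (2 * Suc k) * ?r $ (2 * Suc k)) = 16 * ?r $ (2 * Suc k)"
        using arg_cong[OF central_binomial_Suc[of "Suc k", folded B_def], of "\<lambda>z. 32 * 4 ^ k * z"] unfolding r 3 by (simp add: algebra_simps)
      moreover have "n + 1 = 2 * Suc (Suc k)" "n - 2 + 1 = 2 * Suc k" "n - 1 = 2 * Suc k" "\<not> n < 2" "n \<noteq> 0"
        using 3 by auto
      ultimately show ?thesis by (simp add: fps_X_power_mult_nth del: of_nat_Suc mult_Suc_right)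
    qed
  qed
  then have r': "fps_deriv ?r * h ^ 2 = 16 * fps_X * ?r"
    by (simp add: h algebra_simps numeral_fps_const)
  have "2 * (h * fps_deriv h) = fps_deriv (h ^ 2)" by (simp add: power2_eq_square algebra_simps)
  also have "\<dots> = 2 * (- 16 * fps_X)" unfolding h by (simp add: power2_eq_square algebra_simps)
  finally have "2 * (h * fps_deriv h) = 2 * (- 16 * fps_X)" .
  then have h': "h * fps_deriv h = - 16 * fps_X" by (simp only: mult_cancel_left) simp
  have "h * fps_deriv (?r * h) = fps_deriv ?r * h ^ 2 + ?r * (h * fps_deriv h)"
    by (simp add: power2_eq_square algebra_simps)
  also have "\<dots> = 0" unfolding r' h' by (simp add: algebra_simps)
  finally have "fps_deriv (?r * h) = 0" using h0 by auto
  then have "?r * h = fps_const ((?r * h) $ 0)" by (simp only: fps_deriv_eq_0_iff)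
  then show ?thesis using h0 by (simp add: central_series_def)
qed

text \<open>Even-indexed Catalan numbers have the generating function
  \<open>(sqrt (1 + 4x) - sqrt (1 - 4x)) / (4x)\<close> in \<open>x\<^sup>2\<close>; the identity below is its logarithmic derivative.\<close>

lemma Cat_even_log_deriv:
  assumes c: "c 0 = 1" "\<And>n. c (Suc n) = (\<Sum>i\<le>n. c i * c (n - i))"
  shows "4 * real m * c (2 * m) = (\<Sum>k<m. c (2 * k) * (4 ^ (m - k) * real (2 * (m - k) choose (m - k))))"
proof -
  \<comment> \<open>\<open>b\<close> and \<open>a\<close> are the roots of \<open>1 - 4x\<close> and
    \<open>1 + 4x\<close> with constant term 1. Their difference \<open>g\<close> keeps the odd
    coefficients and equals \<open>4x F(x^2)\<close>, with \<open>F\<close> the series of the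
    even-indexed terms of \<open>c\<close>; \<open>h\<close> is a root of
    \<open>1 - 16x^2\<close>.\<close>
  define b where "b = disc_root c"
  define a where "a = b oo - fps_X"
  define g where "g = a - b"
  define h where "h = a * b"
  have b2: "b ^ 2 = 1 - 4 * fps_X" unfolding b_def using c by (rule disc_root_square)
  have b0: "b $ 0 = 1" by (simp add: b_def disc_root_nth)
  have a0: "a $ 0 = 1" by (simp add: a_def b0)
  have a2: "a ^ 2 = 1 + 4 * fps_X"
  proof -
    have "a ^ 2 = b ^ 2 oo - fps_X"
      unfolding a_def power2_eq_square by (simp add: fps_compose_mult_distrib)
    also have "\<dots> = 1 + 4 * fps_X"
      by (rule fps_ext) (auto simp: b2 fps_compose_uminus' numeral_fps_const le_Suc_eq)
    finally show ?thesis .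
  qed
  have half: "x = y" if "2 * x = 2 * y" for x y :: "real fps" using that by simp
  have aa: "a * fps_deriv a = 2"
  proof (rule half)
    have "fps_deriv (a ^ 2) = 4" by (simp add: a2)
    then show "2 * (a * fps_deriv a) = 2 * 2" by (simp add: power2_eq_square algebra_simps)
  qed
  have bb: "b * fps_deriv b = - 2"
  proof (rule half)
    have "fps_deriv (b ^ 2) = - 4" by (simp add: b2)
    then show "2 * (b * fps_deriv b) = 2 * - 2" by (simp add: power2_eq_square algebra_simps)
  qed
  have h2: "h ^ 2 = 1 - 16 * fps_X ^ 2"
  proof -
    have "h ^ 2 = a ^ 2 * b ^ 2" by (simp add: h_def power_mult_distrib)
    then show ?thesis unfolding a2 b2 by (simp add: algebra_simps power2_eq_square)
  qed
  have g2: "g ^ 2 = 2 - 2 * h"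
  proof -
    have "g ^ 2 = a ^ 2 + b ^ 2 - 2 * (a * b)" by (simp add: g_def power2_eq_square algebra_simps)
    then show ?thesis by (simp add: a2 b2 h_def)
  qed
  have "fps_deriv g * h = (a * fps_deriv a) * b - (b * fps_deriv b) * a"
    by (simp add: g_def h_def algebra_simps)
  then have g'h: "fps_deriv g * h = 2 * (a + b)" unfolding aa bb by (simp add: algebra_simps)
  \<comment> \<open>From \<open>a^2 - b^2 = 8x\<close> and \<open>1 - h^2 = 16x^2\<close> the
    product becomes \<open>2 (1 - h) (1 + h)\<close>, which contains \<open>g^2 = 2 - 2h\<close>;
    after cancelling \<open>g\<close> only \<open>h\<close> is left besides \<open>g\<close> and its
    derivative.\<close>
  have "g * (2 * fps_X * fps_deriv g * h) = 2 * fps_X * (fps_deriv g * h) * g" by (simp add: mult_ac)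
  also have "\<dots> = 4 * fps_X * (a ^ 2 - b ^ 2)"
    unfolding g'h by (simp add: g_def algebra_simps power2_eq_square)
  also have "\<dots> = 2 * (1 - h ^ 2)" unfolding a2 b2 h2 by (simp add: power2_eq_square algebra_simps)
  also have "\<dots> = g ^ 2 * (1 + h)" unfolding g2 by (simp add: power2_eq_square algebra_simps)
  finally have "g * (2 * fps_X * fps_deriv g * h) = g * (g * (1 + h))" by (simp add: power2_eq_square mult_ac)
  moreover have gn: "g $ n = (if odd n then 4 * c (n - 1) else 0)" for n
    by (simp add: g_def a_def fps_compose_uminus' b_def disc_root_nth)
  then have "g $ 1 \<noteq> 0" using c(1) by simp
  then have "g \<noteq> 0" by auto
  ultimately have "2 * fps_X * fps_deriv g * h = g * (1 + h)" by simp
  moreover have "central_series * h = 1"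
    by (rule central_series_mult[OF h2]) (simp add: h_def a0 b0)
  then have "X * h * central_series = X" for X by (simp add: mult.assoc mult.commute[of h])
  moreover have "g * (1 + h) * central_series = g * (central_series + central_series * h)"
    by (simp add: algebra_simps)
  ultimately have "2 * fps_X * fps_deriv g = g * (central_series + 1)"
    using \<open>central_series * h = 1\<close> by metis
  then have "fps_X * (fps_const 2 * fps_deriv g) = (central_series + 1) * g"
    by (simp add: numeral_fps_const mult_ac)
  then have "(fps_X * (fps_const 2 * fps_deriv g)) $ (2 * m + 1) = ((central_series + 1) * g) $ (2 * m + 1)"
    by (simp only:)
  also have "(fps_X * (fps_const 2 * fps_deriv g)) $ (2 * m + 1) = 8 * (2 * real m + 1) * c (2 * m)"
    by (simp add: gn algebra_simps)
  also have "((central_series + 1) * g) $ (2 * m + 1) =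
     (\<Sum>i\<le>2 * m + 1. g $ i * (central_series + 1) $ (2 * m + 1 - i))"
    unfolding mult.commute[of _ g] by (simp add: fps_mult_nth atLeast0AtMost)
  also have "\<dots> = (\<Sum>i | i \<le> 2 * m + 1 \<and> odd i. g $ i * (central_series + 1) $ (2 * m + 1 - i))"
    by (rule sum.mono_neutral_right) (auto simp: gn)
  also have "\<dots> = (\<Sum>k\<le>m. g $ (2 * k + 1) * (central_series + 1) $ (2 * m + 1 - (2 * k + 1)))"
    by (rule sum.reindex_bij_witness[of _ "\<lambda>k. 2 * k + 1" "\<lambda>i. i div 2"]) auto
  also have "\<dots> = (\<Sum>k<Suc m. g $ (2 * k + 1) * (central_series + 1) $ (2 * (m - k)))"
    by (simp add: lessThan_Suc_atMost diff_mult_distrib2)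
  \<comment> \<open>The term \<open>k = m\<close> meets the constant coefficient 2 of
    \<open>central_series + 1\<close>; moved to the left it turns \<open>2 * m + 1\<close> into
    \<open>2 * m\<close>.\<close>
  also have "\<dots> = (\<Sum>k<m. g $ (2 * k + 1) * (central_series + 1) $ (2 * (m - k))) + 8 * c (2 * m)"
    by (simp add: gn central_series_def)
  also have "(\<Sum>k<m. g $ (2 * k + 1) * (central_series + 1) $ (2 * (m - k))) =
      (\<Sum>k<m. 4 * (c (2 * k) * (4 ^ (m - k) * real (2 * (m - k) choose (m - k)))))"
    by (rule sum.cong) (auto simp: gn central_series_def power_mult)
  finally show ?thesis by (simp add: sum_distrib_left[symmetric] algebra_simps)
qed

text \<open>In generating functions: \<open>F = 1 + A F\<close> and \<open>z F' = F D\<close> give \<open>A (zF)' = (zF)' - 1 - D\<close>.\<close>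

lemma sum_components_identity:
  fixes F A D :: "nat \<Rightarrow> real"
  assumes F0: "F 0 = 1" and A: "\<And>m. m \<ge> 1 \<Longrightarrow> F m = (\<Sum>k=1..m. A k * F (m - k))"
    and D0: "D 0 = 0" and D: "\<And>m. real m * F m = (\<Sum>k\<le>m. F k * D (m - k))"
    and m: "m \<ge> 1"
  shows "(\<Sum>k=1..m. real (m - k + 1) * (A k * F (m - k))) = (real m + 1) * F m - D m"
proof -
  define a where "a = Abs_fps (\<lambda>k. if k = 0 then 0 else A k)"
  define f where "f = Abs_fps F"
  define d where "d = Abs_fps D"
  have conv: "(a * p) $ n = (\<Sum>k=1..n. A k * p $ (n - k))" for p n
  proof -
    have "(a * p) $ n = (\<Sum>k=0..n. a $ k * p $ (n - k))" by (rule fps_mult_nth)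
    also have "\<dots> = (\<Sum>k=1..n. a $ k * p $ (n - k))"
      by (rule sum.mono_neutral_right) (auto simp: a_def Suc_le_eq)
    also have "\<dots> = (\<Sum>k=1..n. A k * p $ (n - k))" by (rule sum.cong) (auto simp: a_def)
    finally show ?thesis .
  qed
  have af: "a * f = f - 1"
  proof (rule fps_ext)
    fix n show "(a * f) $ n = (f - 1) $ n"
      unfolding conv using A[of n] F0 by (cases "n = 0") (auto simp: f_def)
  qed
  have fd: "fps_X * fps_deriv f = f * d"
  proof (rule fps_ext)
    fix n
    have "(f * d) $ n = real n * F n" by (simp add: f_def d_def fps_mult_nth atLeast0AtMost D)
    then show "(fps_X * fps_deriv f) $ n = (f * d) $ n" by (cases n) (simp_all add: f_def)
  qed
  let ?s = "a * (f + fps_X * fps_deriv f)"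
  have "f * ?s = (a * f) * (f + fps_X * fps_deriv f)" by (simp add: mult_ac)
  also have "\<dots> = f * (f + fps_X * fps_deriv f - 1 - d)"
    unfolding af fd by (simp add: algebra_simps)
  \<comment> \<open>The common factor \<open>f\<close> is cancelled; its constant term is 1.\<close>
  finally have "?s = f + fps_X * fps_deriv f - 1 - d"
    using F0 by (auto simp: f_def dest: arg_cong[of _ 0 "\<lambda>x. x $ 0"])
  then have "?s $ m = (f + fps_X * fps_deriv f - 1 - d) $ m" by simp
  also have "?s $ m = (\<Sum>k=1..m. real (m - k + 1) * (A k * F (m - k)))"
  proof -
    have "(f + fps_X * fps_deriv f) $ n = real (n + 1) * F n" for n
      by (cases n) (simp_all add: f_def algebra_simps)
    then show ?thesis unfolding conv by (simp only: mult_ac)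
  qed
  also have "(f + fps_X * fps_deriv f - 1 - d) $ m = (real m + 1) * F m - D m"
    using m by (cases m) (simp_all add: f_def d_def algebra_simps)
  finally show ?thesis .
qed

section \<open>Asymptotics\<close>

text \<open>The shift \<open>1/4\<close> makes consecutive ratios \<open>1 + O(n\<^sup>-\<^sup>3)\<close>, precise enough for the second-order term.\<close>

definition central_sq :: "nat \<Rightarrow> real" where
  "central_sq n = (real (2 * n choose n) / 4 ^ n)\<^sup>2 * (real n + 1 / 4)"

text \<open>The ratio of consecutive values is a quotient of two cubics in \<open>n\<close> which,
  with the shift \<open>1/4\<close>, differ only in their constant terms, 5 against 4. Bounding it
  by an exponential turns the later product of ratios into a sum.\<close>

lemma central_sq_Suc:
  assumes "n \<ge> 1"
  shows "central_sq n \<le> central_sq (Suc n)" "central_sq (Suc n) \<le> central_sq n * exp (1 / (16 * real n ^ 3))"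
proof -
  let ?x = "real n" and ?b = "real (2 * n choose n)"
  have x: "?x \<ge> 1" using assms by simp
  have "real (2 * Suc n choose Suc n) = 2 * (2 * ?x + 1) * ?b / (?x + 1)"
    using central_binomial_Suc[of n] by (simp add: field_simps)
  then have "central_sq (Suc n) = (2 * (2 * ?x + 1) * ?b / (?x + 1) / (4 * 4 ^ n))\<^sup>2 * (?x + 5 / 4)"
    by (simp add: central_sq_def)
  also have "\<dots> = (?b / 4 ^ n)\<^sup>2 * (((2 * ?x + 1) / (2 * (?x + 1)))\<^sup>2 * (?x + 5 / 4))"
  proof -
    have "2 * (2 * ?x + 1) * b / (?x + 1) / (4 * p) = b / p * ((2 * ?x + 1) / (2 * (?x + 1)))" for b p :: real
      using x by (cases "p = 0") (simp_all add: frac_eq_eq, simp add: algebra_simps)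
    then show ?thesis by (simp only: power_mult_distrib mult.assoc)
  qed
  also have "((2 * ?x + 1) / (2 * (?x + 1)))\<^sup>2 * (?x + 5 / 4) = (?x + 1 / 4) * (1 + 1 / (4 * (?x + 1)\<^sup>2 * (4 * ?x + 1)))"
    using x by (simp add: divide_simps power2_eq_square) (simp add: algebra_simps)
  finally have eq: "central_sq (Suc n) = central_sq n * (1 + 1 / (4 * (?x + 1)\<^sup>2 * (4 * ?x + 1)))"
    by (simp add: central_sq_def mult.assoc)
  have u0: "0 \<le> central_sq n" by (simp add: central_sq_def)
  show "central_sq n \<le> central_sq (Suc n)" unfolding eq using u0 x by (simp add: mult_le_cancel_left1)
  have "16 * ?x ^ 3 \<le> 4 * (?x + 1)\<^sup>2 * (4 * ?x + 1)"
    using x by (simp add: power2_eq_square power3_eq_cube algebra_simps)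
  then have "1 / (4 * (?x + 1)\<^sup>2 * (4 * ?x + 1)) \<le> 1 / (16 * ?x ^ 3)"
    using x by (intro divide_left_mono) auto
  then have "1 + 1 / (4 * (?x + 1)\<^sup>2 * (4 * ?x + 1)) \<le> exp (1 / (16 * ?x ^ 3))"
    using exp_ge_add_one_self[of "1 / (16 * ?x ^ 3)"] by linarith
  then show "central_sq (Suc n) \<le> central_sq n * exp (1 / (16 * ?x ^ 3))"
    unfolding eq using u0 by (intro mult_left_mono)
qed

text \<open>From \<open>m\<close> to \<open>2 * m\<close> there are \<open>m\<close> steps, each
  with a factor of at most \<open>exp (1 / (16 m^3))\<close>. The resulting error of order
  \<open>m^(-2)\<close> still vanishes after multiplication by \<open>m\<close>.\<close>

lemma central_sq_double:
  assumes m: "m \<ge> 1"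
  shows "central_sq m \<le> central_sq (2 * m)" "central_sq (2 * m) \<le> central_sq m * exp (1 / (16 * real m ^ 2))"
proof -
  have "central_sq m \<le> central_sq (m + j) \<and> central_sq (m + j) \<le> central_sq m * exp (real j / (16 * real m ^ 3))" for j
  proof (induction j)
    case 0
    then show ?case by simp
  next
    case (Suc j)
    have "1 / (16 * real (m + j) ^ 3) \<le> 1 / (16 * real m ^ 3)"
      using m by (intro divide_left_mono mult_left_mono power_mono) auto
    then have "central_sq (m + Suc j) \<le> central_sq (m + j) * exp (1 / (16 * real m ^ 3))"
    proof -
      have "central_sq (m + j) * exp (1 / (16 * real (m + j) ^ 3)) \<le> central_sq (m + j) * exp (1 / (16 * real m ^ 3))"
        using \<open>1 / (16 * real (m + j) ^ 3) \<le> _\<close> by (intro mult_left_mono) (auto simp: central_sq_def)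
      moreover have "central_sq (m + Suc j) \<le> central_sq (m + j) * exp (1 / (16 * real (m + j) ^ 3))"
        using central_sq_Suc(2)[of "m + j"] m by simp
      ultimately show ?thesis by linarith
    qed
    also have "\<dots> \<le> central_sq m * exp (real j / (16 * real m ^ 3)) * exp (1 / (16 * real m ^ 3))"
      using Suc by (intro mult_right_mono) auto
    also have "\<dots> = central_sq m * exp (real (Suc j) / (16 * real m ^ 3))"
      by (simp add: exp_add[symmetric] add_divide_distrib add.commute mult.assoc)
    finally show ?case using Suc central_sq_Suc(1)[of "m + j"] m by auto
  qed
  from this[of m] show "central_sq m \<le> central_sq (2 * m)" "central_sq (2 * m) \<le> central_sq m * exp (1 / (16 * real m ^ 2))"
    using m by (simp_all add: mult_2 power2_eq_square power3_eq_cube)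
qed

lemma Cat_eq_binomial: "Cat n = real (2 * n choose n) / (real n + 1)"
proof -
  have "real (2 * n choose n) = fact (2 * n) / (fact n * fact n)"
    by (simp add: binomial_fact mult_2)
  moreover have "fact (n + 1) = (real n + 1) * fact n" by (simp add: algebra_simps)
  ultimately show ?thesis unfolding Cat_def by simp
qed

text \<open>With \<open>p\<close> and \<open>r\<close> the central binomial coefficients at
  \<open>m\<close> and \<open>2 * m\<close>, scaled by \<open>4 ^ m\<close> and
  \<open>4 ^ (2 * m)\<close>, the quotient is \<open>(m + 1/2) p / r\<close>. As
  \<open>2m + 1/4 = 2 (m + 1/8)\<close>, the definition of \<open>central_sq\<close> makes
  \<open>p / r\<close> equal to \<open>sqrt 2 * w m\<close> times a factor squeezed to 1.\<close>

lemma Cat_ratio_asymp: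
  "(\<lambda>m. 2 ^ (2 * m - 1) * real (2 * m choose m) / Cat (2 * m) - sqrt 2 * real m) \<longlonglongrightarrow> 7 * sqrt 2 / 16"
proof -
  define R where "R m = 2 ^ (2 * m - 1) * real (2 * m choose m) / Cat (2 * m)" for m
  define w where "w m = sqrt ((real m + 1 / 8) / (real m + 1 / 4))" for m :: nat
  have R: "sqrt 2 * ((real m + 1 / 2) * (w m * sqrt (exp (- (1 / (16 * real m ^ 2)))))) \<le> R m"
    "R m \<le> sqrt 2 * ((real m + 1 / 2) * w m)" if m: "m \<ge> 1" for m
  proof -
    let ?p = "real (2 * m choose m) / 4 ^ m" and ?r = "real (2 * (2 * m) choose (2 * m)) / 4 ^ (2 * m)"
    have pos: "0 < ?p" "0 < ?r" by simp_all
    have p2: "(2::real) ^ (2 * m - 1) = 4 ^ m / 2"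
      using m by (cases m) (simp_all add: power_mult)
    have "R m = (4 ^ m / 2) * (4 ^ m * ?p) / ((4 ^ (2 * m) * ?r) / (2 * real m + 1))"
      unfolding R_def Cat_eq_binomial p2 by simp
    also have "\<dots> = (real m + 1 / 2) * (?p / ?r)"
    proof -
      have "(4::real) ^ (2 * m) = 4 ^ m * 4 ^ m" by (simp add: mult_2 power_add)
      then show ?thesis by (simp add: field_simps)
    qed
    finally have R1: "R m = (real m + 1 / 2) * (?p / ?r)" .
    have um: "0 < central_sq m" "0 < central_sq (2 * m)" by (simp_all add: central_sq_def)
    have "(?p / ?r)\<^sup>2 = (central_sq m / central_sq (2 * m)) * (2 * ((real m + 1 / 8) / (real m + 1 / 4)))"
    proof -
      have "central_sq m = ?p\<^sup>2 * (real m + 1 / 4)" "central_sq (2 * m) = ?r\<^sup>2 * (2 * (real m + 1 / 8))"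
        by (simp_all add: central_sq_def)
      moreover have "real m + 1 / 4 > 0" "real m + 1 / 8 > 0" by simp_all
      moreover have "(P / Q)\<^sup>2 = (P\<^sup>2 * s / (Q\<^sup>2 * (2 * t))) * (2 * (t / s))" if "s > 0" "t > 0" "Q > 0" for P Q s t :: real
        using that by (simp add: power_divide)
      ultimately show ?thesis using pos by metis
    qed
    then have "?p / ?r = sqrt ((central_sq m / central_sq (2 * m)) * (2 * ((real m + 1 / 8) / (real m + 1 / 4))))"
      using pos by (metis abs_of_pos divide_pos_pos real_sqrt_abs)
    then have R2: "R m = sqrt 2 * ((real m + 1 / 2) * (w m * sqrt (central_sq m / central_sq (2 * m))))"
      unfolding R1 w_def by (simp only: real_sqrt_mult mult_ac)
    have "central_sq m / central_sq (2 * m) \<le> 1" using central_sq_double(1)[OF m] um by simp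
    moreover have "exp (- (1 / (16 * real m ^ 2))) \<le> central_sq m / central_sq (2 * m)"
      using central_sq_double(2)[OF m] um by (simp add: exp_minus field_simps)
    ultimately have s: "sqrt (central_sq m / central_sq (2 * m)) \<le> 1" "sqrt (exp (- (1 / (16 * real m ^ 2)))) \<le> sqrt (central_sq m / central_sq (2 * m))"
      by simp_all
    have w0: "0 \<le> w m" by (simp add: w_def)
    show "sqrt 2 * ((real m + 1 / 2) * (w m * sqrt (exp (- (1 / (16 * real m ^ 2)))))) \<le> R m"
      unfolding R2 using s(2) w0 by (intro mult_left_mono) auto
    show "R m \<le> sqrt 2 * ((real m + 1 / 2) * w m)"
      unfolding R2 using s(1) w0 by (intro mult_left_mono) (auto intro: mult_left_le)
  qed
  \<comment> \<open>Up to order \<open>m^(-2)\<close>, \<open>w m\<close> is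
    \<open>1 - 1/(16m)\<close>, so the limit is \<open>1/2 - 1/16\<close>.\<close>
  have "(\<lambda>m. (real m + 1 / 2) * (w m * sqrt (exp (- (1 / (16 * real m ^ 2))))) - real m) \<longlonglongrightarrow> 7 / 16"
    unfolding w_def by real_asymp
  from tendsto_mult_left[OF this, of "sqrt 2"]
  have 1: "(\<lambda>m. sqrt 2 * ((real m + 1 / 2) * (w m * sqrt (exp (- (1 / (16 * real m ^ 2)))))) - sqrt 2 * real m) \<longlonglongrightarrow> 7 * sqrt 2 / 16"
    by (simp add: right_diff_distrib mult.commute)
  have "(\<lambda>m. (real m + 1 / 2) * w m - real m) \<longlonglongrightarrow> 7 / 16"
    unfolding w_def by real_asymp
  from tendsto_mult_left[OF this, of "sqrt 2"]
  have 2: "(\<lambda>m. sqrt 2 * ((real m + 1 / 2) * w m) - sqrt 2 * real m) \<longlonglongrightarrow> 7 * sqrt 2 / 16"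
    by (simp add: right_diff_distrib mult.commute)
  show ?thesis
    unfolding R_def[symmetric]
    by (rule tendsto_sandwich[OF _ _ 1 2])
      (use R in \<open>auto intro!: eventually_sequentiallyI[of 1]\<close>)
qed

section \<open>Averages and conclusion\<close>

lemma nc_count_Suc:
  "real (nc_count (Suc n)) = (\<Sum>i\<le>n. real (nc_count i) * real (nc_count (n - i)))"
proof -
  have "nc_count (Suc n) = (\<Sum>k=Suc 0..Suc n. nc_count (k - 1) * nc_count (Suc n - k))"
    using nc_count_rec[of 1 "Suc n"] by (simp add: conn_count_1[unfolded One_nat_def] cong: sum.cong_simp)
  also have "\<dots> = (\<Sum>i\<le>n. nc_count i * nc_count (n - i))"
    unfolding sum.shift_bounds_cl_Suc_ivl by (simp add: atLeast0AtMost)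
  finally show ?thesis by simp
qed

lemma nc_count_eq_Cat: "real (nc_count n) = Cat n"
  by (rule Cat_unique) (simp_all add: nc_count_Suc del: of_nat_Suc)

text \<open>Replacing \<open>k\<close> by \<open>n + 1 - k\<close> exchanges the weights
  \<open>n - k + 1\<close> and \<open>k\<close> and fixes the summand, so twice the sum has the
  constant weight \<open>n + 1\<close>.\<close>

lemma sum_blocks:
  assumes "n \<ge> 1"
  shows "2 * (\<Sum>E\<in>ncr {0<..n}. card ({0<..n} // E)) = (n + 1) * nc_count n"
proof -
  let ?g = "\<lambda>k. nc_count (k - 1) * nc_count (n - k)"
  have "(\<Sum>E\<in>ncr {0<..n}. card ({0<..n} // E)) =
      (\<Sum>E\<in>ncr {0<..1 * n}. card ({0<..1 * n} // join_blocks 1 {0<..1 * n} E))"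
    by (rule sum.cong) (simp_all add: join_blocks_1[unfolded One_nat_def])
  also have "\<dots> = (\<Sum>k=1..n. (n - k + 1) * ?g k)"
    by (subst sum_card_join_blocks) (auto intro!: sum.cong simp: conn_count_1[unfolded One_nat_def])
  finally have 1: "(\<Sum>E\<in>ncr {0<..n}. card ({0<..n} // E)) = (\<Sum>k=1..n. (n - k + 1) * ?g k)" .
  also have "\<dots> = (\<Sum>k=1..n. k * ?g k)"
    by (rule sum.reindex_bij_witness[of _ "\<lambda>k. n + 1 - k" "\<lambda>k. n + 1 - k"])
      (auto simp: Suc_diff_le mult.commute)
  finally have 2: "(\<Sum>E\<in>ncr {0<..n}. card ({0<..n} // E)) = (\<Sum>k=1..n. k * ?g k)" .
  have "2 * (\<Sum>E\<in>ncr {0<..n}. card ({0<..n} // E)) = (\<Sum>k=1..n. (n - k + 1) * ?g k + k * ?g k)"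
    unfolding mult_2 sum.distrib using 1 2 by simp
  also have "\<dots> = (\<Sum>k=1..n. (n + 1) * ?g k)"
    by (rule sum.cong[OF refl], unfold add_mult_distrib[symmetric]) simp
  also have "\<dots> = (n + 1) * nc_count (1 * n)"
    unfolding nc_count_rec[OF order_refl assms] sum_distrib_left
    by (rule sum.cong) (simp_all add: conn_count_1[unfolded One_nat_def])
  finally show ?thesis by simp
qed

lemma sum_components:
  assumes "m \<ge> 1"
  shows "real (\<Sum>E\<in>ncr {0<..2 * m}. card ({0<..2 * m} // join_blocks 2 {0<..2 * m} E)) =
    (real m + 1) * Cat (2 * m) - 4 ^ (m - 1) * real (2 * m choose m)"
proof -
  \<comment> \<open>These are the coefficients of \<open>z F'/F\<close>, read off from
    \<open>Cat_even_log_deriv\<close> after division by 4; at 0 the series vanishes.\<close>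
  define D where "D j = (if j = 0 then 0 else 4 ^ (j - 1) * real (2 * j choose j))" for j
  have c: "Cat 0 = 1" "\<And>n. Cat (Suc n) = (\<Sum>i\<le>n. Cat i * Cat (n - i))"
    using nc_count_Suc by (simp_all add: nc_count_eq_Cat)
  have "real (\<Sum>E\<in>ncr {0<..2 * m}. card ({0<..2 * m} // join_blocks 2 {0<..2 * m} E)) =
      (\<Sum>k=1..m. real (m - k + 1) * (real (conn_count 2 k) * Cat (2 * (m - k))))"
    by (subst sum_card_join_blocks) (simp, simp only: of_nat_sum of_nat_mult nc_count_eq_Cat)
  also have "\<dots> = (real m + 1) * Cat (2 * m) - D m"
  proof (rule sum_components_identity[where F = "\<lambda>m. Cat (2 * m)"])
    fix j :: nat assume "j \<ge> 1"
    from nc_count_rec[OF _ this, of 2] show "Cat (2 * j) = (\<Sum>k=1..j. real (conn_count 2 k) * Cat (2 * (j - k)))"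
      by (simp flip: nc_count_eq_Cat)
  next
    fix j :: nat
    have "4 * (real j * Cat (2 * j)) = (\<Sum>k<j. 4 * (Cat (2 * k) * D (j - k)))"
    proof -
      have "4 * D i = 4 ^ i * real (2 * i choose i)" if "0 < i" for i
        using that by (cases i) (auto simp: D_def)
      then have "Cat (2 * k) * (4 ^ (j - k) * real (2 * (j - k) choose (j - k))) = 4 * (Cat (2 * k) * D (j - k))"
        if "k < j" for k using that by (metis mult.left_commute zero_less_diff)
      then have "(\<Sum>k<j. Cat (2 * k) * (4 ^ (j - k) * real (2 * (j - k) choose (j - k)))) =
          (\<Sum>k<j. 4 * (Cat (2 * k) * D (j - k)))"
        by (intro sum.cong[OF refl]) (simp only: lessThan_iff)
      then show ?thesis
        using Cat_even_log_deriv[OF c, of j] by (simp only: mult.assoc)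
    qed
    then have "real j * Cat (2 * j) = (\<Sum>k<j. Cat (2 * k) * D (j - k))"
      unfolding sum_distrib_left[symmetric] by simp
    then show "real j * Cat (2 * j) = (\<Sum>k\<le>j. Cat (2 * k) * D (j - k))"
      by (simp add: lessThan_Suc_atMost[symmetric] D_def)
  qed (use assms in \<open>simp_all add: D_def\<close>)
  finally show ?thesis using assms by (simp add: D_def)
qed

lemma dtilde2_eq:
  assumes m: "m \<ge> 1"
  shows "dtilde2 m = 2 ^ (2 * m - 1) * real ((2 * m) choose m) / Cat (2 * m) - 3 / 2"
proof -
  let ?S = "{0<..2 * m}"
  have S: "{1..2 * m} = ?S" by auto
  have "(\<Sum>\<rho>\<in>NC (2 * m). d_H (2 * m) (lambda2 m) \<rho>) =
      (\<Sum>\<rho>\<in>NC (2 * m). real m + real (card (?S // rel_of \<rho>)) - 2 * real (card (?S // join_blocks 2 ?S (rel_of \<rho>))))"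
    using d_H_lambda2[of _ m] quotient_rel_of[of _ "2 * m"] unfolding S by (intro sum.cong) simp_all
  also have "\<dots> = (\<Sum>E\<in>ncr ?S. real m + real (card (?S // E)) - 2 * real (card (?S // join_blocks 2 ?S E)))"
    using sum.reindex_bij_betw[OF bij_betw_rel_of[of "2 * m", unfolded S]] .
  also have "\<dots> = real m * nc_count (2 * m) + real (\<Sum>E\<in>ncr ?S. card (?S // E))
      - 2 * real (\<Sum>E\<in>ncr ?S. card (?S // join_blocks 2 ?S E))"
    by (simp add: sum.distrib sum_subtractf sum_distrib_left nc_count_def)
  also have "real (\<Sum>E\<in>ncr ?S. card (?S // E)) = (2 * real m + 1) / 2 * Cat (2 * m)"
  proof -
    have "real (2 * (\<Sum>E\<in>ncr ?S. card (?S // E))) = real ((2 * m + 1) * nc_count (2 * m))"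
      using sum_blocks[of "2 * m"] m by simp
    then show ?thesis by (simp add: nc_count_eq_Cat field_simps)
  qed
  also have "real (\<Sum>E\<in>ncr ?S. card (?S // join_blocks 2 ?S E)) =
      (real m + 1) * Cat (2 * m) - 4 ^ (m - 1) * real (2 * m choose m)"
    by (rule sum_components[OF m])
  \<comment> \<open>The multiples of \<open>m\<close> in front of the Catalan number cancel:
    \<open>m + (2m + 1)/2 - 2 (m + 1) = - 3/2\<close>.\<close>
  finally have "(\<Sum>\<rho>\<in>NC (2 * m). d_H (2 * m) (lambda2 m) \<rho>) =
      2 * 4 ^ (m - 1) * real (2 * m choose m) - 3 / 2 * Cat (2 * m)"
    by (simp add: nc_count_eq_Cat field_simps)
  moreover have "(2::real) * 4 ^ (m - 1) = 2 ^ (2 * m - 1)"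
    using m by (cases m) (simp_all add: power_mult)
  ultimately show ?thesis
    using Cat_pos[of "2 * m"] by (simp add: dtilde2_def diff_divide_distrib)
qed

theorem proposition1p8:
  shows "(\<forall>m\<ge>1. dtilde2 m = 2 ^ (2 * m - 1) * real ((2 * m) choose m) / Cat (2 * m) - 3 / 2) \<and>
    (\<lambda>m. dtilde2 m - sqrt 2 * real m) \<longlonglongrightarrow> 7 * sqrt 2 / 16 - 3 / 2"
proof
  show "\<forall>m\<ge>1. dtilde2 m = 2 ^ (2 * m - 1) * real ((2 * m) choose m) / Cat (2 * m) - 3 / 2"
    using dtilde2_eq by blast
  have "(\<lambda>m. (2 ^ (2 * m - 1) * real (2 * m choose m) / Cat (2 * m) - sqrt 2 * real m) - 3 / 2)
      \<longlonglongrightarrow> 7 * sqrt 2 / 16 - 3 / 2"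
    by (intro tendsto_intros Cat_ratio_asymp)
  moreover have ev: "\<forall>\<^sub>F m in sequentially. dtilde2 m - sqrt 2 * real m =
      (2 ^ (2 * m - 1) * real (2 * m choose m) / Cat (2 * m) - sqrt 2 * real m) - 3 / 2"
    using dtilde2_eq by (intro eventually_sequentiallyI[of 1]) simp
  ultimately show "(\<lambda>m. dtilde2 m - sqrt 2 * real m) \<longlonglongrightarrow> 7 * sqrt 2 / 16 - 3 / 2"
    unfolding tendsto_cong[OF ev] by simp
qed

end
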